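(* Let $\preceq$ be any one of the infix, prefix, extension, or left-extension relations. If the $\preceq$-matching problem (given $w\in\Sigma^*$ and an $\varepsilon$NFA $A$ with $m$ transitions, decide whether some $u\preceq w$ has $u\in\mathcal{L}(A)$) can be solved in time $O((|w|m)^{1-\epsilon})$ for some $\epsilon>0$, then the Strong Exponential Time Hypothesis (SETH) fails. The same holds for the min-variant and the max-variant of the $\preceq$-matching problem, even if they are only required to output the length of the answer string.
   Context: An $\varepsilon$NFA is a tuple $A=(Q,\Sigma,q_0,q_f,\delta)$ with $\delta\subseteq Q\times(\Sigma\cup\{\varepsilon\})\times Q$, size $m=|\delta|$; $\mathcal{L}(A)$ is the set of strings labelling (ignoring $\varepsilon$) a path from $q_0$ to $q_f$. Relations: infix $u\preceq w$ iff $w=vuv'$ for some $v,v'$; prefix iff $w=uv$; left-extension iff $u=vw$; extension iff $u=vwv'$ for some $v,v'$. Min-variant: compute a shortest $u$ with $u\preceq w$, $u\in\mathcal{L}(A)$, or report none exists. Max-variant: report that such $u$ can be arbitrarily long, or compute a longest such $u$, or report none exists. *)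

theory Defs
  imports Complex_Main "HOL-Library.Sublist"
begin

section \<open>Nondeterministic automata with empty transitions\<close>

text \<open>A label \<open>None\<close> is the empty word, \<open>Some a\<close> is the letter \<open>a\<close>.\<close>

record ('q, 'a) enfa =
  states :: "'q set"
  alphabet :: "'a set"
  start :: 'q
  final :: 'q
  trans :: "('q \<times> 'a option \<times> 'q) set"

definition enfa :: "('q, 'a) enfa \<Rightarrow> bool" where
  "enfa A \<longleftrightarrow> finite (states A) \<and> finite (alphabet A) \<and>
     start A \<in> states A \<and> final A \<in> states A \<and>
     trans A \<subseteq> states A \<times> insert None (Some ` alphabet A) \<times> states A"

definition size_enfa :: "('q, 'a) enfa \<Rightarrow> nat" where
  "size_enfa A = card (trans A)"

inductive path :: "('q, 'a) enfa \<Rightarrow> 'q \<Rightarrow> 'a list \<Rightarrow> 'q \<Rightarrow> bool" for A where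
  Nil: "path A q [] q"
| Eps: "(p, None, q) \<in> trans A \<Longrightarrow> path A q u r \<Longrightarrow> path A p u r"
| Letter: "(p, Some a, q) \<in> trans A \<Longrightarrow> path A q u r \<Longrightarrow> path A p (a # u) r"

definition language :: "('q, 'a) enfa \<Rightarrow> 'a list set" where
  "language A = {u. path A (start A) u (final A)}"


section \<open>String relations\<close>

text \<open>In each case the first argument is the string \<open>u\<close> that is looked for and the second
  one is the given string \<open>w\<close>.\<close>

definition infix_rel :: "'a list \<Rightarrow> 'a list \<Rightarrow> bool" where
  "infix_rel u w \<longleftrightarrow> sublist u w"

definition prefix_rel :: "'a list \<Rightarrow> 'a list \<Rightarrow> bool" where
  "prefix_rel u w \<longleftrightarrow> prefix u w"

definition left_extension_rel :: "'a list \<Rightarrow> 'a list \<Rightarrow> bool" where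
  "left_extension_rel u w \<longleftrightarrow> suffix w u"

definition extension_rel :: "'a list \<Rightarrow> 'a list \<Rightarrow> bool" where
  "extension_rel u w \<longleftrightarrow> sublist w u"

definition matches :: "('a list \<Rightarrow> 'a list \<Rightarrow> bool) \<Rightarrow> 'a list \<Rightarrow> ('q, 'a) enfa \<Rightarrow> 'a list set" where
  "matches R w A = {u. R u w \<and> u \<in> language A}"


section \<open>Word RAM\<close>

text \<open>
  A deterministic RAM with finitely many registers (those named in the program) and a
  random-access memory.  Every instruction takes one unit of time.  Registers and memory cells
  hold natural numbers.  The word length is not a parameter of the machine: \<open>ram_run\<close> bounds
  every number that occurs during the run.
\<close>

datatype binop = Add | Sub | Mul | Div | And | Or | Xor | Shl | Shr

unbundle bit_operations_syntax

text \<open>Subtraction is truncated at 0, and division by 0 yields 0.\<close>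

fun apply_binop :: "binop \<Rightarrow> nat \<Rightarrow> nat \<Rightarrow> nat" where
  "apply_binop Add x y = x + y"
| "apply_binop Sub x y = x - y"
| "apply_binop Mul x y = x * y"
| "apply_binop Div x y = x div y"
| "apply_binop And x y = x AND y"
| "apply_binop Or x y = x OR y"
| "apply_binop Xor x y = x XOR y"
| "apply_binop Shl x y = push_bit y x"
| "apply_binop Shr x y = drop_bit y x"

unbundle no bit_operations_syntax

datatype instr =
    Const nat nat
  | Op binop nat nat nat
  | Load nat nat
  | Store nat nat
  | Jump_zero nat nat

type_synonym program = "instr list"

record ram_config =
  pc :: nat
  regs :: "nat \<Rightarrow> nat"
  mem :: "nat \<Rightarrow> nat"

fun exec :: "instr \<Rightarrow> ram_config \<Rightarrow> ram_config" where
  "exec (Const i n) c = c\<lparr>pc := Suc (pc c), regs := (regs c)(i := n)\<rparr>"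
| "exec (Op b i j k) c =
     c\<lparr>pc := Suc (pc c), regs := (regs c)(i := apply_binop b (regs c j) (regs c k))\<rparr>"
| "exec (Load i j) c = c\<lparr>pc := Suc (pc c), regs := (regs c)(i := mem c (regs c j))\<rparr>"
| "exec (Store i j) c = c\<lparr>pc := Suc (pc c), mem := (mem c)(regs c i := regs c j)\<rparr>"
| "exec (Jump_zero i l) c = c\<lparr>pc := (if regs c i = 0 then l else Suc (pc c))\<rparr>"

definition halted :: "program \<Rightarrow> ram_config \<Rightarrow> bool" where
  "halted P c \<longleftrightarrow> pc c \<ge> length P"

definition step :: "program \<Rightarrow> ram_config \<Rightarrow> ram_config" where
  "step P c = (if halted P c then c else exec (P ! pc c) c)"

text \<open>Input and output are lists of words stored from memory address 0 on, with their length in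
  register 0.  All other registers and memory cells are initially 0.\<close>

definition init_config :: "nat list \<Rightarrow> ram_config" where
  "init_config xs =
     \<lparr>pc = 0,
      regs = (\<lambda>i. if i = 0 then length xs else 0),
      mem = (\<lambda>a. if a < length xs then xs ! a else 0)\<rparr>"

definition ram_output :: "ram_config \<Rightarrow> nat list" where
  "ram_output c = map (mem c) [0..<regs c 0]"

definition words_le :: "nat \<Rightarrow> ram_config \<Rightarrow> bool" where
  "words_le B c \<longleftrightarrow> (\<forall>i. regs c i \<le> B) \<and> (\<forall>a. mem c a \<le> B)"

text \<open>\<open>ram_run P e xs t ys\<close>: on input \<open>xs\<close>, program \<open>P\<close> halts after exactly \<open>t\<close> steps with output
  \<open>ys\<close>, and no word ever exceeds the given bound.  The bound says that words have
  \<open>O(log N)\<close> bits, where \<open>N\<close> comprises the length of the input, the numbers occurring in it, and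
  the running time (so that an exponential-time computation can address the memory it uses).\<close>

definition ram_run :: "program \<Rightarrow> nat \<Rightarrow> nat list \<Rightarrow> nat \<Rightarrow> nat list \<Rightarrow> bool" where
  "ram_run P e xs t ys \<longleftrightarrow>
     (\<forall>s\<le>t. words_le ((2 + length xs + sum_list xs + t) ^ e) ((step P ^^ s) (init_config xs))) \<and>
     (\<forall>s<t. \<not> halted P ((step P ^^ s) (init_config xs))) \<and>
     halted P ((step P ^^ t) (init_config xs)) \<and>
     ram_output ((step P ^^ t) (init_config xs)) = ys"

text \<open>A computational problem is given by a relation \<open>enc\<close> between instances and their encodings
  and by a relation \<open>ans\<close> between instances and admissible outputs.  Objects that are not
  encodable are not instances.  An algorithm has to work for every encoding of an instance.
  The \<open>1 +\<close> accounts for instances on which \<open>f\<close> is smaller than 1.\<close>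

definition solvable_in_time ::
    "('i \<Rightarrow> nat list \<Rightarrow> bool) \<Rightarrow> ('i \<Rightarrow> nat list \<Rightarrow> bool) \<Rightarrow> ('i \<Rightarrow> real) \<Rightarrow> bool" where
  "solvable_in_time enc ans f \<longleftrightarrow>
     (\<exists>P e C. \<forall>I xs. enc I xs \<longrightarrow>
        (\<exists>t ys. ram_run P e xs t ys \<and> ans I ys \<and> real t \<le> C * (1 + f I)))"

lemma solvable_in_time_mono:
  assumes "solvable_in_time enc ans f" and "\<And>I. 0 \<le> f I" and "\<And>I. f I \<le> g I"
  shows "solvable_in_time enc ans g"
proof -
  obtain P e C where *: "\<And>I xs. enc I xs \<Longrightarrow>
      \<exists>t ys. ram_run P e xs t ys \<and> ans I ys \<and> real t \<le> C * (1 + f I)"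
    using assms(1) unfolding solvable_in_time_def by blast
  have "C * (1 + f I) \<le> \<bar>C\<bar> * (1 + g I)" for I
    by (rule mult_mono) (use assms(2,3)[of I] in auto)
  with * show ?thesis
    unfolding solvable_in_time_def by (meson order_trans)
qed


section \<open>The matching problem and its variants\<close>

text \<open>For the encoding, states and letters are numbered consecutively from 0.
  The transitions are listed in any order, without repetition.\<close>

fun encode_label :: "nat option \<Rightarrow> nat" where
  "encode_label None = 0"
| "encode_label (Some a) = Suc a"

fun encode_trans :: "nat \<times> nat option \<times> nat \<Rightarrow> nat list" where
  "encode_trans (p, l, q) = [p, encode_label l, q]"

type_synonym matching_instance = "nat list \<times> (nat, nat) enfa"

fun matching_encoding :: "matching_instance \<Rightarrow> nat list \<Rightarrow> bool" where
  "matching_encoding (w, A) xs \<longleftrightarrow>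
     enfa A \<and> set w \<subseteq> alphabet A \<and>
     (\<exists>k s ts. states A = {..<k} \<and> alphabet A = {..<s} \<and> distinct ts \<and> set ts = trans A \<and>
        xs = length w # w @ [k, s, start A, final A, length ts] @ concat (map encode_trans ts))"

fun decision_answer :: "(nat list \<Rightarrow> nat list \<Rightarrow> bool) \<Rightarrow> matching_instance \<Rightarrow> nat list \<Rightarrow> bool" where
  "decision_answer R (w, A) ys \<longleftrightarrow> ys = [if matches R w A \<noteq> {} then 1 else 0]"

text \<open>The first word of an output tells the kind of the answer: 0 if there is no string,
  1 if there is an optimal one (which is then reported), 2 if there are arbitrarily long ones.
  The parameter \<open>out\<close> determines what has to be reported about an optimal string.\<close>

fun min_answer :: "(nat list \<Rightarrow> nat list) \<Rightarrow> (nat list \<Rightarrow> nat list \<Rightarrow> bool) \<Rightarrow>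
    matching_instance \<Rightarrow> nat list \<Rightarrow> bool" where
  "min_answer out R (w, A) ys \<longleftrightarrow>
     (if matches R w A = {} then ys = [0]
      else \<exists>u. is_arg_min length (\<lambda>v. v \<in> matches R w A) u \<and> ys = 1 # out u)"

fun max_answer :: "(nat list \<Rightarrow> nat list) \<Rightarrow> (nat list \<Rightarrow> nat list \<Rightarrow> bool) \<Rightarrow>
    matching_instance \<Rightarrow> nat list \<Rightarrow> bool" where
  "max_answer out R (w, A) ys \<longleftrightarrow>
     (if matches R w A = {} then ys = [0]
      else if \<forall>n. \<exists>u\<in>matches R w A. length u > n then ys = [2]
      else \<exists>u. is_arg_max length (\<lambda>v. v \<in> matches R w A) u \<and> ys = 1 # out u)"

definition whole_string :: "nat list \<Rightarrow> nat list" where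
  "whole_string u = u"

definition only_length :: "nat list \<Rightarrow> nat list" where
  "only_length u = [length u]"

text \<open>
  The bound \<open>O((|w| m)\<^sup>1\<^sup>-\<^sup>\<epsilon>)\<close>, with the time for reading the input, \<open>|w| + m\<close>, understood as usual.
  Without the latter the bound would be sublinear when one of \<open>|w|\<close> and \<open>m\<close> is constant, so
  that no algorithm could meet it.  An algorithm that meets the bound without the additional term
  also meets \<open>matching_time\<close> (lemma \<open>solvable_in_matching_time\<close> below).
\<close>

fun matching_time :: "real \<Rightarrow> matching_instance \<Rightarrow> real" where
  "matching_time \<epsilon> (w, A) =
     (real (length w) * real (size_enfa A)) powr (1 - \<epsilon>) + (real (length w) + real (size_enfa A))"

lemma solvable_in_matching_time:
  assumes "solvable_in_time matching_encoding ans
             (\<lambda>(w, A). (real (length w) * real (size_enfa A)) powr (1 - \<epsilon>))"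
  shows "solvable_in_time matching_encoding ans (matching_time \<epsilon>)"
  by (rule solvable_in_time_mono[OF assms]) auto


section \<open>Satisfiability and the Strong Exponential Time Hypothesis\<close>

text \<open>The literal \<open>(i, True)\<close> is the variable \<open>i\<close>, and \<open>(i, False)\<close> is its negation.\<close>

type_synonym literal = "nat \<times> bool"
type_synonym clause = "literal set"
type_synonym cnf = "clause set"

definition satisfiable :: "cnf \<Rightarrow> bool" where
  "satisfiable F \<longleftrightarrow> (\<exists>\<alpha> :: nat \<Rightarrow> bool. \<forall>C\<in>F. \<exists>(i, b)\<in>C. \<alpha> i = b)"

text \<open>An instance consists of the number \<open>n\<close> of variables and a formula over the variables
  \<open>0, \<dots>, n - 1\<close>.  Since formulas are sets of clauses, an instance of k-SAT has at most
  \<open>O(n\<^sup>k)\<close> clauses, and a time bound in terms of \<open>n\<close> alone makes sense.\<close>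

type_synonym sat_instance = "nat \<times> cnf"

fun ksat_instance :: "nat \<Rightarrow> sat_instance \<Rightarrow> bool" where
  "ksat_instance k (n, F) \<longleftrightarrow> (\<forall>C\<in>F. C \<subseteq> {..<n} \<times> UNIV \<and> card C \<le> k)"

fun encode_literal :: "literal \<Rightarrow> nat" where
  "encode_literal (i, b) = 2 * i + of_bool b"

definition encode_clause :: "literal list \<Rightarrow> nat list" where
  "encode_clause c = length c # map encode_literal c"

fun ksat_encoding :: "nat \<Rightarrow> sat_instance \<Rightarrow> nat list \<Rightarrow> bool" where
  "ksat_encoding k (n, F) xs \<longleftrightarrow>
     ksat_instance k (n, F) \<and>
     (\<exists>cs. (\<forall>c\<in>set cs. distinct c) \<and> distinct (map set cs) \<and> set (map set cs) = F \<and>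
        xs = n # length cs # concat (map encode_clause cs))"

fun sat_answer :: "sat_instance \<Rightarrow> nat list \<Rightarrow> bool" where
  "sat_answer (n, F) ys \<longleftrightarrow> ys = [if satisfiable F then 1 else 0]"

text \<open>For every \<open>\<delta> > 0\<close> there is a \<open>k\<close> such that k-SAT on \<open>n\<close> variables cannot be
  solved in time \<open>O(2\<^sup>(\<^sup>1\<^sup>-\<^sup>\<delta>\<^sup>)\<^sup>n)\<close>.\<close>

definition SETH :: bool where
  "SETH \<longleftrightarrow>
     (\<forall>\<delta>>0. \<exists>k. \<not> solvable_in_time (ksat_encoding k) sat_answer
        (\<lambda>(n, F). 2 powr ((1 - \<delta>) * real n)))"

end

theory Submission
  imports Defs
begin

text \<open>
  Split and list: with \<open>h = \<lceil>n/2\<rceil>\<close>, a formula with clauses \<open>C\<^sub>1, \<dots>, C\<^sub>M\<close> is satisfiable iff there are an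
  assignment \<open>x\<close> of the first \<open>h\<close> variables and an assignment \<open>y\<close> of the others such that no clause is
  left unsatisfied by both. The word \<open>w\<close> lists, for each of the \<open>2\<^sup>h\<close> values of \<open>x\<close>, the block of bits
  telling which clauses \<open>x\<close> leaves open. The automaton guesses a block and compares it with the
  corresponding bits of a guessed \<open>y\<close>. Since \<open>w\<close> and all words of the language begin and end with a letter
  that occurs nowhere else, \<open>R u w\<close> with \<open>u\<close> in the language forces \<open>u = w\<close> for each of the four relations,
  so that decision, minimum and maximum variant all reveal whether \<open>w\<close> is accepted by the first word
  of their output.

  Both \<open>w\<close> and the automaton have size \<open>2\<^sup>h\<close> times a polynomial, so that time \<open>(|w| m)\<^sup>1\<^sup>-\<^sup>\<epsilon> + |w| + m\<close>
  becomes \<open>2\<^sup>(\<^sup>1\<^sup>-\<^sup>\<delta>\<^sup>)\<^sup>n\<close> for \<open>\<delta> < min \<epsilon> (1/2)\<close>, whatever \<open>k\<close> is. The reduction is carried out by a RAM program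
  that writes the matching instance behind its own input and then simulates the given program with shifted
  registers and addresses.
\<close>

section \<open>Automata for pairs of orthogonal blocks\<close>

text \<open>A k-CNF given as a set of clauses has only O(n^k) of them. Half of the saving
  \<open>\<epsilon>' = min \<epsilon> (1/2)\<close> absorbs the polynomial factor which this number
  brings into the instance, so the exponent reached is \<open>1 - \<epsilon>' / 2\<close> for every
  k at once. The cap 1/2 comes from the linear term: a cost K is covered by
  \<open>K powr (2 - 2 * \<epsilon>')\<close> only if that exponent is at least 1. The other
  obstacle is the machine model. Words may grow only polynomially in input and running time, yet the
  program handles numbers near 2^n. This is allowed because writing the instance takes at least 2^h
  steps, so a lower bound on the time is needed besides the upper one. Hence all code is verified
  under an arbitrary word bound \<open>B\<close>, which is compared with the admissible power only
  when the time of the finished run is known.\<close>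

lemma path_append:
  assumes "path A p u q" and "path A q v r"
  shows "path A p (u @ v) r"
  using assms by (induction rule: path.induct) (auto intro: path.intros)

section \<open>Delimited words under the four relations\<close>

lemma sublist_delimited_eq:
  assumes "sublist (x # u @ [x]) (x # v @ [x])" and "x \<notin> set u" and "x \<notin> set v"
  shows "u = v"
proof -
  obtain ps ss where *: "x # v @ [x] = ps @ (x # u @ [x]) @ ss"
    using assms(1) by (auto simp: sublist_def)
  \<comment> \<open>Each word contains \<open>x\<close> exactly twice, so the context
    \<open>ps\<close>, \<open>ss\<close> has no \<open>x\<close>. As the outer word starts and ends
    with \<open>x\<close>, the context is empty.\<close>
  have "count_list (x # v @ [x]) x = 2" "count_list (x # u @ [x]) x = 2"
    using assms(2,3) by (auto simp: count_list_0_iff)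
  then have "count_list ps x = 0" "count_list ss x = 0"
    using arg_cong[OF *, of "\<lambda>z. count_list z x"] by auto
  then have "x \<notin> set ps" "x \<notin> set ss"
    by (auto simp: count_list_0_iff)
  then have "ps = []" "ss = []"
    using * arg_cong[OF *, of last] by (auto simp: Cons_eq_append_conv split: if_splits)
  with * show ?thesis by simp
qed

definition delimited :: "nat list set" where
  "delimited = {3 # u @ [3] | u. 3 \<notin> set u}"

text \<open>Each of the four relations makes one word an infix of the other, and between delimited
  words that forces equality.\<close>

lemma matches_delimited:
  assumes "R \<in> {infix_rel, prefix_rel, extension_rel, left_extension_rel}"
    and "language A \<subseteq> delimited" and "w \<in> delimited"
  shows "matches R w A = (if w \<in> language A then {w} else {})"
proof -
  have "u = w" if "R u w" "u \<in> delimited" for u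
  proof -
    have "sublist u w \<or> sublist w u"
      using assms(1) that(1)
      by (auto simp: infix_rel_def prefix_rel_def extension_rel_def left_extension_rel_def)
    then show ?thesis
      using that(2) assms(3) sublist_delimited_eq[of 3] unfolding delimited_def by fastforce
  qed
  moreover have "R w w"
    using assms(1)
    by (auto simp: infix_rel_def prefix_rel_def extension_rel_def left_extension_rel_def)
  ultimately show ?thesis
    using assms(2) unfolding matches_def by auto
qed

lemma answer_singleton:
  assumes "answer \<in> {decision_answer,
                   min_answer whole_string, min_answer only_length,
                   max_answer whole_string, max_answer only_length}"
    and "matches R w A = (if b then {w} else {})" and "answer R (w, A) ys"
  shows "ys \<noteq> [] \<and> hd ys = of_bool b"
proof -
  \<comment> \<open>Discards the answer code 2: a set with one element has no arbitrarily long
    members.\<close>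
  have "\<not> (\<forall>n. \<exists>u\<in>{w}. length u > n)" by auto
  note bounded = this[THEN if_not_P]
  show ?thesis
  proof (cases b)
    case True
    then have m: "matches R w A = {w}"
      using assms(2) by simp
    from assms(1,3) True show ?thesis
      unfolding insert_iff empty_iff simp_thms
      by (elim disjE)
        (simp_all only: decision_answer.simps min_answer.simps max_answer.simps m bounded, auto)
  next
    case False
    then have m: "matches R w A = {}"
      using assms(2) by simp
    from assms(1,3) False show ?thesis
      unfolding insert_iff empty_iff simp_thms by (elim disjE) (simp_all add: m)
  qed
qed

text \<open>Letters: \<open>0\<close> and \<open>1\<close> are bits, \<open>2\<close> opens a block, \<open>3\<close> delimits the word.\<close>

definition blocks_word :: "(nat \<Rightarrow> nat list) \<Rightarrow> nat \<Rightarrow> nat list" where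
  "blocks_word a N = 3 # concat (map (\<lambda>x. 2 # a x) [0..<N]) @ [3]"

text \<open>State 1 skips what precedes the guessed block, state 2 what follows it. The delimiter is
  read only on leaving the start state 0 and on entering the final state 3.\<close>

definition loop_trans :: "(nat \<times> nat option \<times> nat) list" where
  "loop_trans = [(0, Some 3, 1), (1, Some 0, 1), (1, Some 1, 1), (1, Some 2, 1),
                 (2, Some 0, 2), (2, Some 1, 2), (2, Some 2, 2), (2, Some 3, 3)]"

text \<open>A bit \<open>1\<close> in the automaton forbids the letter \<open>1\<close>: the second transition then
  carries the letter \<open>2\<close>, which never occurs inside a block.\<close>

definition gadget_trans :: "nat \<Rightarrow> nat list \<Rightarrow> (nat \<times> nat option \<times> nat) list" where
  "gadget_trans p bs = (1, Some 2, p) #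
     concat (map (\<lambda>j. [(p + j, Some 0, p + j + 1), (p + j, Some (1 + bs ! j), p + j + 1)])
       [0..<length bs]) @
     [(p + length bs, None, 2)]"

text \<open>The states 0 to 3 are shared; gadget \<open>y\<close> owns the \<open>M + 1\<close>
  states from \<open>4 + y * (M + 1)\<close> on, one before each bit and one after the last.\<close>

definition gadgets_trans :: "nat \<Rightarrow> (nat \<Rightarrow> nat list) \<Rightarrow> nat \<Rightarrow> (nat \<times> nat option \<times> nat) list" where
  "gadgets_trans M b N = loop_trans @ concat (map (\<lambda>y. gadget_trans (4 + y * (M + 1)) (b y)) [0..<N])"

definition gadgets_enfa :: "nat \<Rightarrow> (nat \<Rightarrow> nat list) \<Rightarrow> nat \<Rightarrow> (nat, nat) enfa" where
  "gadgets_enfa M b N = \<lparr>states = {..<4 + N * (M + 1)}, alphabet = {..<4}, start = 0, final = 3,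
     trans = set (gadgets_trans M b N)\<rparr>"

section \<open>Size and distinctness of the transitions\<close>

lemma set_gadget_trans:
  "set (gadget_trans p bs) = {(1, Some 2, p), (p + length bs, None, 2)} \<union>
     (\<lambda>j. (p + j, Some 0, p + j + 1)) ` {..<length bs} \<union>
     (\<lambda>j. (p + j, Some (1 + bs ! j), p + j + 1)) ` {..<length bs}"
  by (auto simp: gadget_trans_def)

lemma length_gadgets_trans:
  assumes "\<And>y. length (b y) = M"
  shows "length (gadgets_trans M b N) = 8 + 2 * (N * (M + 1))"
proof -
  have "length (concat (map (\<lambda>j. [f j, g j]) [0..<n])) = 2 * n" for f g :: "nat \<Rightarrow> 'x" and n
    by (induction n) auto
  then have "length (gadget_trans p (b y)) = 2 * (M + 1)" for p y
    by (simp add: gadget_trans_def assms)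
  then have "length (concat (map (\<lambda>y. gadget_trans (4 + y * (M + 1)) (b y)) [0..<N])) = 2 * (N * (M + 1))"
    by (induction N) auto
  then show ?thesis
    by (simp add: gadgets_trans_def loop_trans_def)
qed

text \<open>Identifies the gadget of a transition: on entering and leaving, the other end is the
  shared state 1 or 2, so the larger end always lies in the gadget's own range.\<close>

lemma gadget_trans_max_state:
  assumes "t \<in> set (gadget_trans p bs)" and "2 \<le> p"
  shows "max (fst t) (snd (snd t)) \<in> {p..p + length bs}"
  using assms by (auto simp: set_gadget_trans)

lemma distinct_gadget_trans:
  assumes "4 \<le> p"
  shows "distinct (gadget_trans p bs)"
proof -
  have "distinct (concat (map (\<lambda>j. [(p + j, Some (0::nat), p + j + 1),
      (p + j, Some (1 + bs ! j), p + j + 1)]) [0..<n]))" for n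
    by (induction n) auto
  then show ?thesis
    using assms by (auto simp: gadget_trans_def)
qed

text \<open>\<open>matching_encoding\<close> demands a list without repetition, and distinctness
  makes the number of transitions equal to the length of the list.\<close>

lemma distinct_gadgets_trans:
  assumes "\<And>y. length (b y) = M"
  shows "distinct (gadgets_trans M b N)"
proof -
  let ?g = "\<lambda>y. gadget_trans (4 + y * (M + 1)) (b y)"
  have disj: "set (?g x) \<inter> set (?g y) = {}" if "x < y" for x y
  proof -
    have "Suc x * (M + 1) \<le> y * (M + 1)"
      using that by (intro mult_right_mono) auto
    then have less: "4 + x * (M + 1) + M < 4 + y * (M + 1)"
      by simp
    have "max (fst t) (snd (snd t)) \<le> 4 + x * (M + 1) + M" if "t \<in> set (?g x)" for t
      using gadget_trans_max_state[OF that] by (simp add: assms)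
    moreover have "4 + y * (M + 1) \<le> max (fst t) (snd (snd t))" if "t \<in> set (?g y)" for t
      using gadget_trans_max_state[OF that] by simp
    ultimately show ?thesis
      using less by fastforce
  qed
  have "distinct (concat (map ?g [0..<N]))"
  proof (induction N)
    case (Suc N)
    then show ?case
      using disj[of _ N] distinct_gadget_trans[of "4 + N * (M + 1)" "b N"] by fastforce
  qed simp
  moreover have "set loop_trans \<inter> set (?g y) = {}" for y
    using gadget_trans_max_state[of _ "4 + y * (M + 1)" "b y"]
    by (fastforce simp: loop_trans_def)
  moreover have "distinct loop_trans"
    by (simp add: loop_trans_def)
  ultimately show ?thesis
    by (auto simp: gadgets_trans_def)
qed

lemma size_gadgets_enfa:
  assumes "\<And>y. length (b y) = M"
  shows "size_enfa (gadgets_enfa M b N) = 8 + 2 * (N * (M + 1))"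
  using distinct_card[OF distinct_gadgets_trans[of b M N]] assms
  by (simp add: size_enfa_def gadgets_enfa_def length_gadgets_trans)

text \<open>The letters offered by the two parallel transitions. For bits it means that no position
  carries 1 twice, since \<open>1 + b\<close> is no bit when \<open>b\<close> is 1.\<close>

definition compatible :: "nat list \<Rightarrow> nat list \<Rightarrow> bool" where
  "compatible bs u \<longleftrightarrow> list_all2 (\<lambda>b c. c = 0 \<or> c = 1 + b) bs u"

lemma enfa_gadgets_enfa:
  assumes "\<And>y. length (b y) = M" and "\<And>y. set (b y) \<subseteq> {0, 1}"
  shows "enfa (gadgets_enfa M b N)"
proof -
  have bit: "b y ! j \<le> 1" if "j < M" for y j
    using assms nth_mem[of j "b y"] that by fastforce
  have bound: "y * (M + 1) + j < N * (M + 1)" if "y < N" "j \<le> M" for y j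
  proof -
    have "Suc y * (M + 1) \<le> N * (M + 1)"
      using that by (intro mult_right_mono) auto
    with that show ?thesis by simp
  qed
  have "t \<in> {..<4 + N * (M + 1)} \<times> insert None (Some ` {..<4}) \<times> {..<4 + N * (M + 1)}"
    if "y < N" "t \<in> set (gadget_trans (4 + y * (M + 1)) (b y))" for y t
    using that(2) bound[OF that(1)] bound[OF that(1), of 0] bound[OF that(1), of M] bit[of _ y]
    unfolding set_gadget_trans by (fastforce simp: assms(1) less_eq_Suc_le)
  then have "set (gadgets_trans M b N)
      \<subseteq> {..<4 + N * (M + 1)} \<times> insert None (Some ` {..<4}) \<times> {..<4 + N * (M + 1)}"
    unfolding gadgets_trans_def set_append set_concat
    by (intro Un_least) (fastforce simp: loop_trans_def)+
  then show ?thesis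
    by (simp add: enfa_def gadgets_enfa_def)
qed

text \<open>Describes the words accepted from each state, so that an induction on paths goes
  through; \<open>drop j\<close> keeps the bits still to be compared. Only one inclusion uses it,
  the converse builds paths directly.\<close>

inductive residual :: "nat \<Rightarrow> (nat \<Rightarrow> nat list) \<Rightarrow> nat \<Rightarrow> nat \<Rightarrow> nat list \<Rightarrow> bool" for M b N where
  final: "residual M b N 3 []"
| tail: "set v \<subseteq> {0, 1, 2} \<Longrightarrow> residual M b N 2 (v @ [3])"
| gadget: "y < N \<Longrightarrow> j \<le> M \<Longrightarrow> compatible (drop j (b y)) u \<Longrightarrow> set v \<subseteq> {0, 1, 2} \<Longrightarrow>
    residual M b N (4 + y * (M + 1) + j) (u @ v @ [3])"
| skip: "set v' \<subseteq> {0, 1, 2} \<Longrightarrow> y < N \<Longrightarrow> compatible (b y) u \<Longrightarrow> set v \<subseteq> {0, 1, 2} \<Longrightarrow>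
    residual M b N 1 (v' @ 2 # u @ v @ [3])"
| start: "residual M b N 1 u \<Longrightarrow> residual M b N 0 (3 # u)"


lemma residual_1:
  assumes "residual M b N 1 u"
  obtains v' y u' v where "u = v' @ 2 # u' @ v @ [3]" "set v' \<subseteq> {0, 1, 2}" "y < N"
    "compatible (b y) u'" "set v \<subseteq> {0, 1, 2}"
  using assms by cases auto

lemma residual_0:
  assumes "residual M b N 0 u"
  obtains u' where "u = 3 # u'" "residual M b N 1 u'"
  using assms
proof cases
  case (start u')
  then show ?thesis by (rule that)
next
  case (gadget y j u' v)
  from gadget(1) have False by simp
  then show ?thesis ..
qed (simp_all only: zero_neq_numeral zero_neq_one)

lemma residual_2:
  assumes "residual M b N 2 u"
  obtains v where "u = v @ [3]" "set v \<subseteq> {0, 1, 2}"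
  using assms by cases auto

lemma residual_3: "residual M b N 3 u \<Longrightarrow> u = []"
  by (erule residual.cases) auto

text \<open>Because \<open>j \<le> M\<close>, quotient and remainder modulo \<open>M + 1\<close>
  recover gadget and position from the state number.\<close>

lemma residual_gadget:
  assumes "residual M b N (4 + y * (M + 1) + j) u" and "j \<le> M"
  obtains u' v where "u = u' @ v @ [3]" "compatible (drop j (b y)) u'" "set v \<subseteq> {0, 1, 2}"
proof -
  have eq: "y' = y \<and> j' = j" if "4 + y * (M + 1) + j = 4 + y' * (M + 1) + j'" "j' \<le> M" for y' j'
  proof -
    have *: "(z * d + i) div d = z" "(z * d + i) mod d = i" if "i < d" for z i d :: nat
      using that by auto
    have "y * (M + 1) + j = y' * (M + 1) + j'"
      using that(1) by linarith
    with *[of j "M + 1" y] *[of j' "M + 1" y'] assms(2) that(2) show ?thesis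
      by (metis less_Suc_eq_le Suc_eq_plus1)
  qed
  from assms(1) show ?thesis
  proof cases
    case (gadget y' j' u' v)
    with eq[of y' j'] that show ?thesis by blast
  qed auto
qed

section \<open>Accepting runs of the gadget automaton\<close>

lemma trans_gadgets_enfa_cases:
  assumes "(p, l, q) \<in> trans (gadgets_enfa M b N)" and "\<And>y. length (b y) = M"
  obtains (loop) "(p, l, q) \<in> set loop_trans"
  | (enter) y where "y < N" "p = 1" "l = Some 2" "q = 4 + y * (M + 1)"
  | (leave) y where "y < N" "p = 4 + y * (M + 1) + M" "l = None" "q = 2"
  | (step) y j a where "y < N" "j < M" "p = 4 + y * (M + 1) + j" "q = 4 + y * (M + 1) + Suc j"
      "l = Some a" "a = 0 \<or> a = 1 + b y ! j"
  using assms by (auto simp: gadgets_enfa_def gadgets_trans_def set_gadget_trans)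

lemma path_residual:
  assumes "path (gadgets_enfa M b N) p u q" and "q = 3" and len: "\<And>y. length (b y) = M"
  shows "residual M b N p u"
  using assms(1,2)
proof (induction rule: path.induct)
  case (Nil q)
  then show ?case by (simp add: residual.final)
next
  case (Eps p q u r)
  then have IH: "residual M b N q u" by blast
  from Eps.hyps(1) len show ?case
  proof (cases rule: trans_gadgets_enfa_cases)
    \<comment> \<open>The exit state is position \<open>j = M\<close>, where no bit is left to
      compare.\<close>
    case (leave y)
    from IH obtain v where "u = v @ [3]" "set v \<subseteq> {0, 1, 2}"
      unfolding leave by (rule residual_2)
    then show ?thesis
      using residual.gadget[OF leave(1), of M M b "[]" v] len leave(2) by (simp add: compatible_def)
  qed (auto simp: loop_trans_def)
next
  case (Letter p a q u r)
  then have IH: "residual M b N q u" by blast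
  from Letter.hyps(1) len show ?case
  proof (cases rule: trans_gadgets_enfa_cases)
    case loop
    then consider "p = 0" "a = 3" "q = 1" | "p = 1" "a \<in> {0, 1, 2}" "q = 1"
      | "p = 2" "a \<in> {0, 1, 2}" "q = 2" | "p = 2" "a = 3" "q = 3"
      unfolding loop_trans_def by auto
    then show ?thesis
    proof cases
      case 1
      then show ?thesis using IH by (simp add: residual.start)
    next
      case 2
      from IH[unfolded 2(3)] obtain v' y u' v where "u = v' @ 2 # u' @ v @ [3]" "set v' \<subseteq> {0, 1, 2}"
          "y < N" "compatible (b y) u'" "set v \<subseteq> {0, 1, 2}"
        by (rule residual_1)
      then show ?thesis
        using residual.skip[of "a # v'" y N b u' v M] 2 by simp
    next
      case 3
      from IH[unfolded 3(3)] obtain v where "u = v @ [3]" "set v \<subseteq> {0, 1, 2}"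
        by (rule residual_2)
      then show ?thesis
        using residual.tail[of "a # v"] 3 by simp
    next
      case 4
      then show ?thesis
        using residual_3[of M b N u] IH residual.tail[of "[]"] by simp
    qed
  next
    case (enter y)
    from IH have "residual M b N (4 + y * (M + 1) + 0) u" by (simp add: enter)
    then obtain u' v where "u = u' @ v @ [3]" "compatible (drop 0 (b y)) u'" "set v \<subseteq> {0, 1, 2}"
      by (rule residual_gadget) simp
    then show ?thesis
      using residual.skip[of "[]" y N b u' v M] enter by simp
  next
    case (leave y)
    then show ?thesis by simp
  next
    case (step y j a')
    from IH have "residual M b N (4 + y * (M + 1) + Suc j) u" by (simp add: step)
    then obtain u' v where u: "u = u' @ v @ [3]" "compatible (drop (Suc j) (b y)) u'"
        "set v \<subseteq> {0, 1, 2}"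
      by (rule residual_gadget) (use step(2) in simp)
    have "drop j (b y) = b y ! j # drop (Suc j) (b y)"
      using step(2) len by (simp add: Cons_nth_drop_Suc)
    then have "compatible (drop j (b y)) (a # u')"
      using u(2) step(5,6) by (simp add: compatible_def)
    then show ?thesis
      using residual.gadget[OF step(1), of j M b "a # u'" v] u step(2,3) by simp
  qed
qed

lemma path_loop:
  assumes "\<And>a. a \<in> {0, 1, 2} \<Longrightarrow> (p, Some a, p) \<in> trans A" and "set u \<subseteq> {0, 1, 2}"
  shows "path A p u p"
  using assms(2) by (induction u) (auto intro: path.intros assms(1))

lemma path_gadget:
  assumes "y < N" and len: "length (b y) = M" and "compatible (drop j (b y)) u" and "j \<le> M"
  shows "path (gadgets_enfa M b N) (4 + y * (M + 1) + j) u 2"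
  using assms(3,4)
proof (induction u arbitrary: j)
  case Nil
  then have "j = M"
    using len by (simp add: compatible_def)
  moreover have "(4 + y * (M + 1) + M, None, 2) \<in> trans (gadgets_enfa M b N)"
    using assms(1) len
    by (auto simp: gadgets_enfa_def gadgets_trans_def set_gadget_trans intro!: bexI[of _ y])
  ultimately show ?case
    by (auto intro: path.intros)
next
  case (Cons a u)
  then have "j < M"
    using len by (cases "j = M") (auto simp: compatible_def)
  then have "drop j (b y) = b y ! j # drop (Suc j) (b y)"
    using len by (simp add: Cons_nth_drop_Suc)
  with Cons.prems have *: "a = 0 \<or> a = 1 + b y ! j" "compatible (drop (Suc j) (b y)) u"
    by (auto simp: compatible_def)
  have "(4 + y * (M + 1) + j, Some a, 4 + y * (M + 1) + Suc j) \<in> trans (gadgets_enfa M b N)"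
    unfolding gadgets_enfa_def gadgets_trans_def
    using assms(1) len *(1) \<open>j < M\<close>
    by (auto simp: set_gadget_trans intro!: bexI[of _ y])
  then show ?case
    using Cons.IH[OF *(2)] \<open>j < M\<close> by (auto intro: path.intros)
qed

lemma language_gadgets_enfa:
  assumes len: "\<And>y. length (b y) = M"
  shows "language (gadgets_enfa M b N) =
    {3 # v' @ 2 # u @ v @ [3] | v' u v y. set v' \<subseteq> {0, 1, 2} \<and> y < N \<and> compatible (b y) u \<and>
       set v \<subseteq> {0, 1, 2}}" (is "?L = ?K")
proof
  show "?L \<subseteq> ?K"
  proof
    fix w assume "w \<in> ?L"
    then have "path (gadgets_enfa M b N) 0 w 3"
      by (simp add: language_def gadgets_enfa_def)
    from path_residual[OF this refl len] have "residual M b N 0 w" .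
    then obtain u where u: "w = 3 # u" "residual M b N 1 u"
      by (rule residual_0)
    from u(2) obtain v' y u' v where "u = v' @ 2 # u' @ v @ [3]" "set v' \<subseteq> {0, 1, 2}"
        "y < N" "compatible (b y) u'" "set v \<subseteq> {0, 1, 2}"
      by (rule residual_1)
    with u(1) show "w \<in> ?K"
      by blast
  qed
  show "?K \<subseteq> ?L"
  proof clarify
    fix v' u v :: "nat list" and y
    assume *: "set v' \<subseteq> {0, 1, 2}" "y < N" "compatible (b y) u" "set v \<subseteq> {0, 1, 2}"
    let ?A = "gadgets_enfa M b N"
    have loop: "t \<in> trans ?A" if "t \<in> set loop_trans" for t
      using that by (simp add: gadgets_enfa_def gadgets_trans_def)
    have "path ?A 1 v' 1" "path ?A 2 v 2"
      using * by (auto intro!: path_loop loop simp: loop_trans_def)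
    moreover have "path ?A 1 [2] (4 + y * (M + 1) + 0)"
      using *(2) by (intro path.Letter[OF _ path.Nil])
        (auto simp: gadgets_enfa_def gadgets_trans_def set_gadget_trans)
    moreover have "path ?A (4 + y * (M + 1) + 0) u 2"
      using * len by (intro path_gadget) auto
    moreover have "path ?A 0 [3] 1" "path ?A 2 [3] 3"
      by (auto intro!: path.Letter[OF _ path.Nil] loop simp: loop_trans_def)
    ultimately have "path ?A 0 ([3] @ v' @ [2] @ u @ v @ [3]) 3"
      by (blast intro: path_append)
    then show "3 # v' @ 2 # u @ v @ [3] \<in> ?L"
      by (simp add: language_def gadgets_enfa_def)
  qed
qed

text \<open>A gadget may read 2 where its bit is 1, but reading 3 would require a bit equal to
  2.\<close>

lemma language_gadgets_enfa_delimited: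
  assumes "\<And>y. length (b y) = M" and "\<And>y. set (b y) \<subseteq> {0, 1}"
  shows "language (gadgets_enfa M b N) \<subseteq> delimited"
proof
  fix w assume "w \<in> language (gadgets_enfa M b N)"
  then obtain v' u v y where w: "w = 3 # (v' @ 2 # u @ v) @ [3]" "set v' \<subseteq> {0, 1, 2}" "set v \<subseteq> {0, 1, 2}"
      and u: "compatible (b y) u"
    unfolding language_gadgets_enfa[of b, OF assms(1)] by auto
  have "3 \<notin> set u"
  proof
    assume "3 \<in> set u"
    then obtain i where "i < length u" "u ! i = 3"
      by (auto simp: in_set_conv_nth)
    with u have "b y ! i = 2" "i < length (b y)"
      unfolding compatible_def by (auto dest: list_all2_nthD2 list_all2_lengthD)
    with assms(2)[of y] show False
      by (metis (no_types, lifting) insertE nth_mem numeral_eq_one_iff semiring_norm(85) singletonD subsetD zero_neq_numeral)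
  qed
  with w have "3 \<notin> set (v' @ 2 # u @ v)" by auto
  with w(1) show "w \<in> delimited" unfolding delimited_def by blast
qed

text \<open>Blocks consist of bits, so every 2 opens a block.\<close>

lemma block_after_separator:
  assumes "concat (map (\<lambda>x. 2 # a x) xs) = v' @ 2 # r" and "\<And>x. set (a x) \<subseteq> {0, 1 :: nat}"
  shows "\<exists>x\<in>set xs. prefix (a x) r"
  using assms(1)
proof (induction xs arbitrary: v')
  case (Cons x xs)
  let ?c = "concat (map (\<lambda>x. 2 # a x) xs)"
  show ?case
  proof (cases v')
    case Nil
    with Cons.prems show ?thesis by (auto simp: prefix_def)
  next
    case (Cons c v'')
    with Cons.prems have "a x @ ?c = v'' @ 2 # r" by simp
    then consider us where "a x = v'' @ us" "us @ ?c = 2 # r" | us where "?c = us @ 2 # r"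
      unfolding append_eq_append_conv2 by blast
    then show ?thesis
    proof cases
      \<comment> \<open>\<open>us\<close> is the rest of a block of bits and cannot start with the
        separator; hence it is empty and the separator opens a later block.\<close>
      case 1
      from 1(1) assms(2)[of x] have "us = [] \<or> hd us \<in> {0, 1}" by (cases us) auto
      with 1 have "?c = [] @ 2 # r" by (cases us) auto
      then show ?thesis using Cons.IH by auto
    qed (use Cons.IH in auto)
  qed
qed simp

text \<open>A run enters a gadget by reading 2, hence at the start of a block. Gadget and block both
  have length \<open>M\<close>, so it reads exactly this block.\<close>

lemma blocks_word_in_language:
  assumes b: "\<And>y. length (b y) = M" "\<And>y. set (b y) \<subseteq> {0, 1}"
    and a: "\<And>x. length (a x) = M" "\<And>x. set (a x) \<subseteq> {0, 1}"
  shows "blocks_word a N \<in> language (gadgets_enfa M b N) \<longleftrightarrow>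
    (\<exists>x<N. \<exists>y<N. \<forall>j<M. a x ! j = 0 \<or> b y ! j = 0)"
proof -
  have compat: "compatible (b y) (a x) \<longleftrightarrow> (\<forall>j<M. a x ! j = 0 \<or> b y ! j = 0)" for x y
  proof -
    have "a x ! j \<in> {0, 1}" "b y ! j \<in> {0, 1}" if "j < M" for j
      using a b that by (metis nth_mem subsetD)+
    then have "(a x ! j = 0 \<or> a x ! j = 1 + b y ! j) \<longleftrightarrow> (a x ! j = 0 \<or> b y ! j = 0)" if "j < M" for j
      using that by fastforce
    then show ?thesis
      using a b by (auto simp: compatible_def list_all2_conv_all_nth)
  qed
  show ?thesis
  proof
    assume "blocks_word a N \<in> language (gadgets_enfa M b N)"
    then obtain v' u v y where *: "y < N" "compatible (b y) u"
        "concat (map (\<lambda>x. 2 # a x) [0..<N]) = v' @ 2 # (u @ v)"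
      unfolding language_gadgets_enfa[of b, OF b(1)] blocks_word_def by auto
    from block_after_separator[OF *(3) a(2)] obtain x where x: "x < N" "prefix (a x) (u @ v)"
      by auto
    have "length u = length (a x)"
      using *(2) a b by (simp add: compatible_def list_all2_lengthD[symmetric])
    moreover obtain zs where "u @ v = a x @ zs"
      using x(2) by (rule prefixE)
    ultimately have "u = a x"
      using append_eq_append_conv[of u "a x" v zs] by simp
    with *(2) have "\<forall>j<M. a x ! j = 0 \<or> b y ! j = 0"
      by (simp only: compat)
    with x(1) *(1) show "\<exists>x<N. \<exists>y<N. \<forall>j<M. a x ! j = 0 \<or> b y ! j = 0"
      by blast
  next
    assume "\<exists>x<N. \<exists>y<N. \<forall>j<M. a x ! j = 0 \<or> b y ! j = 0"
    then obtain x y where xy: "x < N" "y < N" "compatible (b y) (a x)"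
      by (auto simp only: compat)
    let ?c = "\<lambda>xs. concat (map (\<lambda>x. 2 # a x) xs)"
    have "[0..<N] = [0..<x] @ x # [Suc x..<N]"
      using xy(1) upt_add_eq_append[of 0 x "N - x"] by (simp add: upt_conv_Cons)
    then have "?c [0..<N] = ?c [0..<x] @ 2 # a x @ ?c [Suc x..<N]" by simp
    moreover have "set (a x) \<subseteq> {0, 1, 2}" for x
      using a(2)[of x] by auto
    then have "set (?c xs) \<subseteq> {0, 1, 2}" for xs
      by (induction xs) simp_all
    moreover note xy
    moreover from calculation(1) have
      "blocks_word a N = 3 # ?c [0..<x] @ 2 # a x @ ?c [Suc x..<N] @ [3]"
      unfolding blocks_word_def by simp
    ultimately show "blocks_word a N \<in> language (gadgets_enfa M b N)"
      unfolding language_gadgets_enfa[of b, OF b(1)] by blast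
  qed
qed

lemma blocks_word_delimited:
  assumes "\<And>x. set (a x) \<subseteq> {0, 1}"
  shows "blocks_word a N \<in> delimited" and "set (blocks_word a N) \<subseteq> {..<4}"
proof -
  have "set (a x) \<subseteq> {0, 1, 2}" for x
    using assms[of x] by auto
  then have *: "set (concat (map (\<lambda>x. 2 # a x) [0..<N])) \<subseteq> {0, 1, 2}"
    by (induction N) simp_all
  define u where "u = concat (map (\<lambda>x. 2 # a x) [0..<N])"
  from * have "set u \<subseteq> {0, 1, 2}"
    unfolding u_def .
  then show "blocks_word a N \<in> delimited" "set (blocks_word a N) \<subseteq> {..<4}"
    unfolding delimited_def blocks_word_def u_def[symmetric] by auto
qed

lemma length_blocks_word:
  assumes "\<And>x. length (a x) = M"
  shows "length (blocks_word a N) = 2 + N * (M + 1)"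
  by (induction N) (auto simp: blocks_word_def assms)


section \<open>Splitting the variables\<close>

unbundle bit_operations_syntax

text \<open>The bit of a literal with code \<open>l\<close>: \<open>pos\<close> contains the values of the variables of one half,
  \<open>msk\<close> tells which variables belong to this half. Literals of the other half yield 0.\<close>

definition lit_bit :: "nat \<Rightarrow> nat \<Rightarrow> nat \<Rightarrow> nat" where
  "lit_bit pos msk l = drop_bit (drop_bit 1 l) (((1 - (l AND 1)) * msk) XOR pos) AND 1"

text \<open>XOR is addition without carries. The bound keeps the words of the literal test
  small.\<close>

lemma xor_le_add: "x XOR y \<le> x + y" for x y :: nat
proof (induction x arbitrary: y rule: less_induct)
  case (less x)
  show ?case
  proof (cases "x = 0")
    case False
    then have "x div 2 XOR y div 2 \<le> x div 2 + y div 2"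
      by (intro less.IH) auto
    then show ?thesis
      by (subst xor_rec) (auto elim!: oddE evenE)
  qed simp
qed

text \<open>The low bit of a literal code is its sign. For a negative literal the XOR with the mask
  flips exactly the bits of this half; outside it, mask and values both vanish.\<close>

lemma lit_bit_half:
  assumes "x < 2 ^ h"
  shows "lit_bit (x * 2 ^ s) ((2 ^ h - 1) * 2 ^ s) (encode_literal (i, b)) =
    of_bool (s \<le> i \<and> i < s + h \<and> bit x (i - s) = b)"
proof -
  have lit: "lit_bit pos msk l = of_bool (bit (((1 - of_bool (odd l)) * msk) XOR pos) (l div 2))" for pos msk l
  proof -
    have "y AND 1 = of_bool (odd y)" for y :: nat
      by (simp add: and_one_eq mod2_eq_if)
    then show ?thesis
      by (simp add: lit_bit_def bit_iff_odd_drop_bit drop_bit_eq_div)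
  qed
  have x: "bit (x * 2 ^ s) i \<longleftrightarrow> s \<le> i \<and> bit x (i - s)"
    by (metis bit_push_bit_iff_nat push_bit_eq_mult)
  have "(2 ^ h - 1 :: nat) * 2 ^ s = push_bit s (mask h)"
    by (simp add: push_bit_eq_mult mask_eq_exp_minus_1)
  then have m: "bit ((2 ^ h - 1 :: nat) * 2 ^ s) i \<longleftrightarrow> s \<le> i \<and> i - s < h"
    by (simp add: bit_push_bit_iff_nat bit_mask_iff)
  have "\<not> bit x (i - s)" if "\<not> i - s < h"
    using that assms by (metis bit_take_bit_iff take_bit_nat_eq_self)
  then show ?thesis
    using x m by (cases b) (auto simp: lit bit_xor_iff)
qed

text \<open>The bit 1 marks a clause that this half leaves open, so a satisfying assignment is a
  pair without a common 1. An empty clause yields 1 in both halves.\<close>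

definition clause_bit :: "nat \<Rightarrow> nat \<Rightarrow> nat list \<Rightarrow> nat" where
  "clause_bit pos msk ls = of_bool (\<forall>l\<in>set ls. lit_bit pos msk l = 0)"

lemma clause_bit_eq_0: "clause_bit pos msk ls = 0 \<longleftrightarrow> (\<exists>l\<in>set ls. lit_bit pos msk l \<noteq> 0)"
  by (auto simp: clause_bit_def)

text \<open>\<open>h\<close> may be rounded up: for odd \<open>n\<close> a dummy variable at the top
  gives both halves the same number of values.\<close>

lemma satisfiable_split:
  assumes "\<And>c. c \<in> set cs \<Longrightarrow> set c \<subseteq> {..<n} \<times> UNIV" and "n \<le> 2 * h"
  defines "msk \<equiv> 2 ^ h - 1"
  shows "satisfiable (set (map set cs)) \<longleftrightarrow>
    (\<exists>x<2 ^ h. \<exists>y<2 ^ h. \<forall>c\<in>set cs. clause_bit x msk (map encode_literal c) = 0 \<or>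
      clause_bit (y * 2 ^ h) (msk * 2 ^ h) (map encode_literal c) = 0)"
proof -
  have bits: "clause_bit x msk (map encode_literal c) = 0 \<or>
      clause_bit (y * 2 ^ h) (msk * 2 ^ h) (map encode_literal c) = 0 \<longleftrightarrow>
      (\<exists>(i, b)\<in>set c. (if i < h then bit x i else bit y (i - h)) = b)"
    if "x < 2 ^ h" "y < 2 ^ h" "c \<in> set cs" for x y c
  proof -
    have "(lit_bit x msk (encode_literal l) \<noteq> 0 \<or>
        lit_bit (y * 2 ^ h) (msk * 2 ^ h) (encode_literal l) \<noteq> 0) \<longleftrightarrow>
        (case l of (i, b) \<Rightarrow> (if i < h then bit x i else bit y (i - h)) = b)" if "l \<in> set c" for l
    proof -
      obtain i b where l: "l = (i, b)" by force
      then have "i < h + h"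
        using assms(1)[OF \<open>c \<in> set cs\<close>] that assms(2) by fastforce
      then show ?thesis
        using lit_bit_half[OF \<open>x < 2 ^ h\<close>, of 0 i b] lit_bit_half[OF \<open>y < 2 ^ h\<close>, of h i b] l
        by (simp add: msk_def del: encode_literal.simps)
    qed
    then show ?thesis
      unfolding clause_bit_eq_0 set_map bex_simps by blast
  qed
  show ?thesis
  proof
    assume "satisfiable (set (map set cs))"
    then obtain \<alpha> where \<alpha>: "\<forall>c\<in>set cs. \<exists>(i, b)\<in>set c. \<alpha> i = b"
      by (auto simp: satisfiable_def)
    \<comment> \<open>Packs the truth values of the \<open>h\<close> variables from \<open>s\<close>
      on into one number, lowest variable first.\<close>
    define val :: "nat \<Rightarrow> nat" where "val s = horner_sum of_bool 2 (map (\<lambda>i. \<alpha> (s + i)) [0..<h])" for s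
    have val: "val s < 2 ^ h" "bit (val s) i \<longleftrightarrow> i < h \<and> \<alpha> (s + i)" for s i
      using horner_sum_of_bool_2_less[of "map (\<lambda>i. \<alpha> (s + i)) [0..<h]"]
      by (auto simp: val_def bit_horner_sum_bit_iff)
    have "clause_bit (val 0) msk (map encode_literal c) = 0 \<or>
        clause_bit (val h * 2 ^ h) (msk * 2 ^ h) (map encode_literal c) = 0" if c: "c \<in> set cs" for c
    proof -
      from \<alpha> c obtain i where "(i, \<alpha> i) \<in> set c" by auto
      moreover from this have "i < 2 * h"
        using assms(1)[OF c] assms(2) by fastforce
      then have "(if i < h then bit (val 0) i else bit (val h) (i - h)) = \<alpha> i"
        by (auto simp: val)
      ultimately show ?thesis
        unfolding bits[OF val(1) val(1) c] by blast
    qed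
    then show "\<exists>x<2 ^ h. \<exists>y<2 ^ h. \<forall>c\<in>set cs. clause_bit x msk (map encode_literal c) = 0 \<or>
        clause_bit (y * 2 ^ h) (msk * 2 ^ h) (map encode_literal c) = 0"
      by (intro exI[of _ "val 0"] exI[of _ "val h"] conjI ballI val(1))
  next
    assume "\<exists>x<2 ^ h. \<exists>y<2 ^ h. \<forall>c\<in>set cs. clause_bit x msk (map encode_literal c) = 0 \<or>
        clause_bit (y * 2 ^ h) (msk * 2 ^ h) (map encode_literal c) = 0"
    then obtain x y where xy: "x < 2 ^ h" "y < 2 ^ h" "\<forall>c\<in>set cs. clause_bit x msk (map encode_literal c) = 0 \<or>
        clause_bit (y * 2 ^ h) (msk * 2 ^ h) (map encode_literal c) = 0" by (elim exE conjE)
    define \<alpha> where "\<alpha> i = (if i < h then bit x i else bit y (i - h))" for i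
    have "\<exists>(i, b)\<in>set c. \<alpha> i = b" if "c \<in> set cs" for c
      using bspec[OF xy(3) that] unfolding bits[OF xy(1,2) that] \<alpha>_def .
    then show "satisfiable (set (map set cs))"
      unfolding satisfiable_def set_map by blast
  qed
qed

unbundle no bit_operations_syntax


section \<open>Reasoning about RAM programs\<close>

text \<open>\<open>ram_run\<close> freed from initial and halting configurations and with a fixed
  bound, so that runs can be concatenated.\<close>

definition runs :: "program \<Rightarrow> nat \<Rightarrow> ram_config \<Rightarrow> nat \<Rightarrow> ram_config \<Rightarrow> bool" where
  "runs P B c t c' \<longleftrightarrow>
     (\<forall>s\<le>t. words_le B ((step P ^^ s) c)) \<and> (\<forall>s<t. \<not> halted P ((step P ^^ s) c)) \<and>
     (step P ^^ t) c = c'"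

lemma ram_run_runs:
  "ram_run P e xs t ys \<longleftrightarrow>
     (\<exists>c. runs P ((2 + length xs + sum_list xs + t) ^ e) (init_config xs) t c \<and>
       halted P c \<and> ram_output c = ys)"
  by (auto simp: ram_run_def runs_def)

lemma runs_0: "words_le B c \<Longrightarrow> runs P B c 0 c"
  by (simp add: runs_def)

lemma runs_Suc:
  assumes "\<not> halted P c" and "words_le B c" and "runs P B (exec (P ! pc c) c) t c'"
  shows "runs P B c (Suc t) c'"
proof -
  have step: "step P c = exec (P ! pc c) c"
    using assms(1) by (simp add: step_def)
  have "words_le B ((step P ^^ s) c)" if "s \<le> Suc t" for s
    using that assms(2,3) step by (cases s) (auto simp: runs_def funpow_swap1 simp del: funpow.simps(2) simp add: funpow_Suc_right)
  moreover have "\<not> halted P ((step P ^^ s) c)" if "s < Suc t" for s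
    using that assms(1,3) step by (cases s) (auto simp: runs_def simp del: funpow.simps(2) simp add: funpow_Suc_right)
  ultimately show ?thesis
    using assms(3) step by (simp add: runs_def funpow_Suc_right del: funpow.simps(2))
qed

lemma runs_trans:
  assumes "runs P B c t c'" and "runs P B c' t' c''"
  shows "runs P B c (t + t') c''"
proof -
  have shift: "(step P ^^ (s + t)) c = (step P ^^ s) c'" for s
    using assms(1) by (simp add: runs_def funpow_add)
  have "words_le B ((step P ^^ s) c)" if "s \<le> t + t'" for s
  proof (cases "s \<le> t")
    case False
    then show ?thesis
      using that assms(2) shift[of "s - t"] by (simp add: runs_def)
  qed (use assms(1) in \<open>simp add: runs_def\<close>)
  moreover have "\<not> halted P ((step P ^^ s) c)" if "s < t + t'" for s
  proof (cases "s < t")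
    case False
    then show ?thesis
      using that assms(2) shift[of "s - t"] by (simp add: runs_def)
  qed (use assms(1) in \<open>simp add: runs_def\<close>)
  ultimately show ?thesis
    using assms(2) shift[of t'] by (simp add: runs_def add.commute)
qed

lemma runs_final_words_le: "runs P B c t c' \<Longrightarrow> words_le B c'"
  by (auto simp: runs_def)

lemma words_le_mono: "words_le B c \<Longrightarrow> B \<le> B' \<Longrightarrow> words_le B' c"
  unfolding words_le_def using order_trans by blast

lemma runs_mono: "runs P B c t c' \<Longrightarrow> B \<le> B' \<Longrightarrow> runs P B' c t c'"
  unfolding runs_def using words_le_mono by blast

text \<open>Each step writes at most one cell, so the set of changed cells gains at most one
  element. This turns the amount of output into a lower bound on time.\<close>

lemma runs_changed_cells:
  assumes "runs P B c t c'"
  shows "finite {a. mem c' a \<noteq> mem c a}" and "card {a. mem c' a \<noteq> mem c a} \<le> t"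
proof -
  have one: "\<exists>b. \<forall>a. a \<noteq> b \<longrightarrow> mem (step P d) a = mem d a" for d
  proof (cases "halted P d")
    case False
    then show ?thesis
      by (cases "P ! pc d") (auto simp: step_def)
  qed (simp add: step_def)
  let ?D = "\<lambda>t. {a. mem ((step P ^^ t) c) a \<noteq> mem c a}"
  have "finite (?D t) \<and> card (?D t) \<le> t" for t
  proof (induction t)
    case (Suc t)
    obtain b where "\<forall>a. a \<noteq> b \<longrightarrow> mem (step P ((step P ^^ t) c)) a = mem ((step P ^^ t) c) a"
      using one by blast
    then have sub: "?D (Suc t) \<subseteq> insert b (?D t)" by auto
    with Suc have "finite (?D (Suc t))"
      by (meson finite_insert rev_finite_subset)
    moreover have "card (?D (Suc t)) \<le> card (insert b (?D t))"
      using sub Suc by (intro card_mono) auto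
    ultimately show ?case
      using Suc card_insert_le_m1[of "Suc t" "?D t" b] by (simp add: card_insert_if split: if_splits)
  qed simp
  then show "finite {a. mem c' a \<noteq> mem c a}" "card {a. mem c' a \<noteq> mem c a} \<le> t"
    using assms by (auto simp: runs_def)
qed

text \<open>Code is a function of its position in the program, since jump targets are absolute.\<close>

type_synonym code = "nat \<Rightarrow> instr list"

type_synonym assn = "(nat \<Rightarrow> nat) \<Rightarrow> (nat \<Rightarrow> nat) \<Rightarrow> bool"

text \<open>A weakest precondition for total correctness, with bounds \<open>T\<close> on the time and \<open>B\<close> on all words.\<close>

definition reaches :: "nat \<Rightarrow> code \<Rightarrow> nat \<Rightarrow> assn \<Rightarrow> assn" where
  "reaches B c T Q R m \<longleftrightarrow>
     (\<forall>us vs. words_le B \<lparr>pc = length us, regs = R, mem = m\<rparr> \<longrightarrow>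
       (\<exists>t\<le>T. \<exists>R' m'. runs (us @ c (length us) @ vs) B \<lparr>pc = length us, regs = R, mem = m\<rparr> t
           \<lparr>pc = length us + length (c (length us)), regs = R', mem = m'\<rparr> \<and> Q R' m'))"

section \<open>Rules for sequences, straight-line code and loops\<close>

lemma words_le_config:
  "words_le B \<lparr>pc = n, regs = R, mem = m\<rparr> \<longleftrightarrow> (\<forall>i. R i \<le> B) \<and> (\<forall>a. m a \<le> B)"
  by (simp add: words_le_def)

lemma reaches_mono:
  assumes "reaches B c T Q R m" and "T \<le> T'" and "\<And>R m. Q R m \<Longrightarrow> Q' R m"
  shows "reaches B c T' Q' R m"
  using assms unfolding reaches_def by (meson order_trans)

definition seq_code :: "code \<Rightarrow> code \<Rightarrow> code" (infixr ";;" 65) where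
  "(c ;; d) a = c a @ d (a + length (c a))"

lemma reaches_seq:
  assumes "reaches B c T (reaches B d T' Q) R m"
  shows "reaches B (c ;; d) (T + T') Q R m"
  unfolding reaches_def
proof (intro allI impI)
  fix us vs :: program
  assume "words_le B \<lparr>pc = length us, regs = R, mem = m\<rparr>"
  let ?c = "c (length us)" let ?us' = "us @ ?c" let ?d = "d (length ?us')"
  from assms \<open>words_le B _\<close> obtain t R' m' where t: "t \<le> T"
      "runs (us @ ?c @ (?d @ vs)) B \<lparr>pc = length us, regs = R, mem = m\<rparr> t
        \<lparr>pc = length us + length ?c, regs = R', mem = m'\<rparr>" "reaches B d T' Q R' m'"
    unfolding reaches_def[of B c] by blast
  from t(2) have "words_le B \<lparr>pc = length ?us', regs = R', mem = m'\<rparr>"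
    by (auto dest: runs_final_words_le)
  with t(3) obtain t' R'' m'' where t': "t' \<le> T'" "Q R'' m''"
      "runs (?us' @ ?d @ vs) B \<lparr>pc = length ?us', regs = R', mem = m'\<rparr> t'
        \<lparr>pc = length ?us' + length ?d, regs = R'', mem = m''\<rparr>"
    unfolding reaches_def by blast
  have "runs (us @ (c ;; d) (length us) @ vs) B \<lparr>pc = length us, regs = R, mem = m\<rparr> (t + t')
      \<lparr>pc = length us + length ((c ;; d) (length us)), regs = R'', mem = m''\<rparr>"
    using runs_trans[OF t(2)] t'(3) by (simp add: seq_code_def add.assoc)
  with t t' show "\<exists>s\<le>T + T'. \<exists>R' m'. runs (us @ (c ;; d) (length us) @ vs) B
      \<lparr>pc = length us, regs = R, mem = m\<rparr> s
      \<lparr>pc = length us + length ((c ;; d) (length us)), regs = R', mem = m'\<rparr> \<and> Q R' m'"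
    by (meson add_mono)
qed

text \<open>Symbolic execution of code without jumps. Only \<open>Const\<close> and
  \<open>Op\<close> create new words, so only they are checked against \<open>B\<close>.\<close>

fun straight :: "nat \<Rightarrow> instr list \<Rightarrow> assn \<Rightarrow> assn" where
  "straight B [] Q R m \<longleftrightarrow> Q R m"
| "straight B (Const i n # is) Q R m \<longleftrightarrow> n \<le> B \<and> straight B is Q (R(i := n)) m"
| "straight B (Op b i j k # is) Q R m \<longleftrightarrow>
     apply_binop b (R j) (R k) \<le> B \<and> straight B is Q (R(i := apply_binop b (R j) (R k))) m"
| "straight B (Load i j # is) Q R m \<longleftrightarrow> straight B is Q (R(i := m (R j))) m"
| "straight B (Store i j # is) Q R m \<longleftrightarrow> straight B is Q R (m(R i := R j))"
| "straight B (Jump_zero i l # is) Q R m \<longleftrightarrow> False"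

lemma straight_mono: "straight B is Q R m \<Longrightarrow> (\<And>R m. Q R m \<Longrightarrow> Q' R m) \<Longrightarrow> straight B is Q' R m"
  by (induction B "is" Q R m rule: straight.induct) (simp_all del: fun_upd_apply)

lemma straight_append:
  "straight B (is @ js) Q R m \<longleftrightarrow> straight B is (straight B js Q) R m"
  by (induction B "is" Q R m rule: straight.induct) (simp_all del: fun_upd_apply)

lemma reaches_straight:
  assumes "straight B is Q R m"
  shows "reaches B (\<lambda>_. is) (length is) Q R m"
proof -
  have "\<exists>R' m'. runs (us @ is @ vs) B \<lparr>pc = length us, regs = R, mem = m\<rparr> (length is)
      \<lparr>pc = length us + length is, regs = R', mem = m'\<rparr> \<and> Q R' m'"
    if "straight B is Q R m" "words_le B \<lparr>pc = length us, regs = R, mem = m\<rparr>" for us vs :: program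
    using that
  proof (induction "is" arbitrary: us R m)
    case Nil
    then show ?case
      by (intro exI[of _ R] exI[of _ m]) (simp add: runs_0)
  next
    case (Cons i "is")
    let ?c = "\<lparr>pc = length us, regs = R, mem = m\<rparr>"
    obtain R' m' where e: "exec i ?c = \<lparr>pc = length (us @ [i]), regs = R', mem = m'\<rparr>"
        and s: "straight B is Q R' m'" and w: "words_le B \<lparr>pc = length (us @ [i]), regs = R', mem = m'\<rparr>"
      using Cons.prems by (cases i) (auto simp: words_le_config)
    from Cons.IH[OF s w] obtain R'' m'' where
      *: "runs ((us @ [i]) @ is @ vs) B \<lparr>pc = length (us @ [i]), regs = R', mem = m'\<rparr> (length is)
        \<lparr>pc = length (us @ [i]) + length is, regs = R'', mem = m''\<rparr>" "Q R'' m''" by blast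
    have "runs (us @ (i # is) @ vs) B ?c (Suc (length is))
        \<lparr>pc = length (us @ [i]) + length is, regs = R'', mem = m''\<rparr>"
      using * e Cons.prems(2) by (intro runs_Suc) (auto simp: halted_def)
    with *(2) show ?case
      by (intro exI[of _ R''] exI[of _ m'']) simp
  qed
  with assms show ?thesis
    unfolding reaches_def by blast
qed

lemma reaches_straight_le:
  "straight B is Q R m \<Longrightarrow> length is \<le> T \<Longrightarrow> reaches B (\<lambda>_. is) T Q R m"
  using reaches_straight reaches_mono by blast

text \<open>By convention, register 2 contains the number 1 and register 3 the number 0.\<close>

definition repeat_code :: "nat \<Rightarrow> code \<Rightarrow> code" where
  "repeat_code r c a = Jump_zero r (a + length (c (Suc a)) + 3) # c (Suc a) @
     [Op Sub r r 2, Jump_zero 3 a]"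

text \<open>The counter runs down while the invariant is indexed by completed passes and asserted
  for the state after the decrement, which the loop itself performs. A pass costs three extra steps:
  test, decrement, and a jump that is unconditional because register 3 is 0. The final 1 is the test
  that exits.\<close>

lemma reaches_repeat:
  assumes body: "\<And>i R m. i < n \<Longrightarrow> Inv i R m \<Longrightarrow> R r = n - i \<Longrightarrow>
      reaches B c T (\<lambda>R' m'. R' r = n - i \<and> R' 2 = 1 \<and> R' 3 = 0 \<and>
        Inv (Suc i) (R'(r := n - Suc i)) m') R m"
    and init: "Inv 0 R m" "R r = n" and r: "r \<noteq> 3"
    and final: "\<And>R m. Inv n R m \<Longrightarrow> R r = 0 \<Longrightarrow> Q R m"
  shows "reaches B (repeat_code r c) (n * (T + 3) + 1) Q R m"
proof -
  have "\<exists>t\<le>k * (T + 3) + 1. \<exists>R' m'.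
      runs (us @ repeat_code r c (length us) @ vs) B \<lparr>pc = length us, regs = R, mem = m\<rparr> t
        \<lparr>pc = length us + length (repeat_code r c (length us)), regs = R', mem = m'\<rparr> \<and> Q R' m'"
    if "k \<le> n" "Inv (n - k) R m" "R r = k" "words_le B \<lparr>pc = length us, regs = R, mem = m\<rparr>"
    for us vs :: program and k R m
    using that
  proof (induction k arbitrary: R m)
    case 0
    let ?P = "us @ repeat_code r c (length us) @ vs"
    let ?c' = "\<lparr>pc = length us + length (repeat_code r c (length us)), regs = R, mem = m\<rparr>"
    have "runs ?P B \<lparr>pc = length us, regs = R, mem = m\<rparr> (Suc 0) ?c'"
      using 0 runs_0[of B ?c' ?P] by (intro runs_Suc) (simp_all add: halted_def repeat_code_def words_le_config numeral_3_eq_3)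
    with final[of R m] 0 show ?case
      by (intro exI[of _ 1] conjI exI[of _ R] exI[of _ m]) auto
  next
    case (Suc k)
    let ?P = "us @ repeat_code r c (length us) @ vs"
    let ?j = "Jump_zero r (length us + length (c (Suc (length us))) + 3)"
    let ?us' = "us @ [?j]" let ?c = "c (length ?us')"
    let ?vs' = "[Op Sub r r 2, Jump_zero 3 (length us)] @ vs"
    have P: "?P = ?us' @ ?c @ ?vs'"
      by (simp add: repeat_code_def)
    let ?i = "n - Suc k"
    have i: "?i < n" "n - ?i = Suc k" "Suc ?i = n - k" "n - (n - k) = k"
      using Suc.prems(1) by auto
    have w: "words_le B \<lparr>pc = length ?us', regs = R, mem = m\<rparr>"
      using Suc.prems(4) by (simp add: words_le_config)
    from body[OF i(1) Suc.prems(2)] Suc.prems(3)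
    have "reaches B c T (\<lambda>R' m'. R' r = Suc k \<and> R' 2 = 1 \<and> R' 3 = 0 \<and>
        Inv (n - k) (R'(r := k)) m') R m"
      by (simp only: i simp_thms True_implies_equals)
    with w obtain t R' m' where t: "t \<le> T"
        "runs (?us' @ ?c @ ?vs') B \<lparr>pc = length ?us', regs = R, mem = m\<rparr> t
          \<lparr>pc = length ?us' + length ?c, regs = R', mem = m'\<rparr>"
        "R' r = Suc k" "R' 2 = 1" "R' 3 = 0" "Inv (n - k) (R'(r := k)) m'"
      unfolding reaches_def by blast
    have w': "words_le B \<lparr>pc = length ?us' + length ?c, regs = R', mem = m'\<rparr>"
      using t(2) by (rule runs_final_words_le)
    then have w'': "words_le B \<lparr>pc = a, regs = R'(r := k), mem = m'\<rparr>" for a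
      using t(3) by (auto simp: words_le_config) (metis Suc_leD)
    from Suc.IH[OF _ t(6) _ w''] Suc.prems(1) obtain t' R'' m'' where t': "t' \<le> k * (T + 3) + 1"
        "runs ?P B \<lparr>pc = length us, regs = R'(r := k), mem = m'\<rparr> t'
          \<lparr>pc = length us + length (repeat_code r c (length us)), regs = R'', mem = m''\<rparr>" "Q R'' m''"
      by (metis Suc_leD fun_upd_same)
    have "runs ?P B \<lparr>pc = length us, regs = R, mem = m\<rparr> (Suc t)
        \<lparr>pc = length ?us' + length ?c, regs = R', mem = m'\<rparr>"
      using t(2) Suc.prems(3,4) P by (intro runs_Suc) (auto simp: halted_def)
    moreover have "runs ?P B \<lparr>pc = length ?us' + length ?c, regs = R', mem = m'\<rparr> (Suc (Suc t'))
        \<lparr>pc = length us + length (repeat_code r c (length us)), regs = R'', mem = m''\<rparr>"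
    proof (intro runs_Suc)
      have "?P ! (length ?us' + length ?c) = Op Sub r r 2"
        unfolding P by (simp only: nth_append_length_plus append_Cons nth_append_length)
      then have e: "exec (?P ! pc \<lparr>pc = length ?us' + length ?c, regs = R', mem = m'\<rparr>)
          \<lparr>pc = length ?us' + length ?c, regs = R', mem = m'\<rparr> =
          \<lparr>pc = Suc (length ?us' + length ?c), regs = R'(r := k), mem = m'\<rparr>" (is "?l = ?d")
        using t by simp
      show "\<not> halted ?P ?l" "words_le B ?l"
        unfolding e using w'' by (auto simp: halted_def repeat_code_def)
      have "?P ! Suc (length ?us' + length ?c) = Jump_zero 3 (length us)"
        unfolding P by (simp add: nth_append)
      then show "runs ?P B (exec (?P ! pc ?l) ?l) t'
          \<lparr>pc = length us + length (repeat_code r c (length us)), regs = R'', mem = m''\<rparr>"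
        unfolding e using t'(2) t(5) r by simp
    qed (use w' in \<open>auto simp: halted_def repeat_code_def\<close>)
    ultimately have "runs ?P B \<lparr>pc = length us, regs = R, mem = m\<rparr> (Suc t + Suc (Suc t'))
        \<lparr>pc = length us + length (repeat_code r c (length us)), regs = R'', mem = m''\<rparr>"
      by (rule runs_trans)
    moreover have "Suc t + Suc (Suc t') \<le> Suc k * (T + 3) + 1"
      using t(1) t'(1) by simp
    ultimately show ?case using t'(3) by blast
  qed
  from this[of n R m] init show ?thesis
    unfolding reaches_def by simp
qed


section \<open>Simulation on a used machine\<close>

text \<open>Simulation of a program that is not started on a fresh machine: register \<open>i\<close> is kept in
  register \<open>i + 20\<close>, address \<open>a\<close> is moved to \<open>base + a\<close>, where register 1 contains \<open>base\<close>.
  Jumps beyond the end of the program (of length \<open>k\<close>) are redirected to its end, where the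
  surrounding program goes on.\<close>

fun shift_instr :: "nat \<Rightarrow> nat \<Rightarrow> instr \<Rightarrow> instr list" where
  "shift_instr l k (Const i n) = [Const (i + 20) n, Const 19 0]"
| "shift_instr l k (Op b i j k') = [Op b (i + 20) (j + 20) (k' + 20), Const 19 0]"
| "shift_instr l k (Load i j) = [Op Add 19 (j + 20) 1, Load (i + 20) 19]"
| "shift_instr l k (Store i j) = [Op Add 19 (i + 20) 1, Store 19 (j + 20)]"
| "shift_instr l k (Jump_zero i j) = [Const 19 0, Jump_zero (i + 20) (l + 2 * min j k)]"

definition shift_program :: "program \<Rightarrow> code" where
  "shift_program P l = concat (map (shift_instr l (length P)) P)"

text \<open>\<open>Const 19 0\<close> pads each translation to two instructions, so instruction
  \<open>j\<close> starts at \<open>l + 2 * j\<close> and jump targets translate by a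
  formula.\<close>

lemma length_shift_instr: "length (shift_instr l k i) = 2"
  by (cases i) auto

lemma length_shift_program: "length (shift_program P l) = 2 * length P"
proof -
  have "length (concat (map (shift_instr l k) P)) = 2 * length P" for k
    by (induction P) (auto simp: length_shift_instr)
  then show ?thesis by (simp add: shift_program_def)
qed

lemma nth_shift_program:
  assumes "i < length P"
  shows "shift_program P l ! (2 * i) = shift_instr l (length P) (P ! i) ! 0"
    and "shift_program P l ! Suc (2 * i) = shift_instr l (length P) (P ! i) ! 1"
proof -
  have "concat (map (shift_instr l k) Q) ! (2 * i) = shift_instr l k (Q ! i) ! 0 \<and>
      concat (map (shift_instr l k) Q) ! Suc (2 * i) = shift_instr l k (Q ! i) ! 1"
    if "i < length Q" for k Q
    using that
  proof (induction Q arbitrary: i)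
    case (Cons q Q)
    then show ?case
      by (cases i) (auto simp: nth_append length_shift_instr)
  qed simp
  with assms show "shift_program P l ! (2 * i) = shift_instr l (length P) (P ! i) ! 0"
      "shift_program P l ! Suc (2 * i) = shift_instr l (length P) (P ! i) ! 1"
    by (auto simp: shift_program_def)
qed

text \<open>Cells below \<open>base\<close> are left free, since they keep the earlier input. The
  word bound of \<open>d\<close> is therefore carried separately.\<close>

definition simulates :: "nat \<Rightarrow> nat \<Rightarrow> nat \<Rightarrow> ram_config \<Rightarrow> ram_config \<Rightarrow> bool" where
  "simulates l k base d c \<longleftrightarrow> pc d = l + 2 * min (pc c) k \<and> regs d 1 = base \<and>
     (\<forall>i. regs d (i + 20) = regs c i) \<and> (\<forall>a. mem d (base + a) = mem c a)"

text \<open>The bound grows by \<open>base\<close> because register 19 holds shifted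
  addresses.\<close>

lemma simulates_step:
  assumes sim: "simulates l (length P) base d c" and "\<not> halted P c"
    and words: "words_le B c" "words_le B (step P c)" "words_le (B + base) d"
    and P': "P' = us @ shift_program P l @ vs" "length us = l"
  shows "\<exists>d'. runs P' (B + base) d 2 d' \<and> simulates l (length P) base d' (step P c)"
proof -
  let ?i = "P ! pc c"
  have pc: "pc c < length P" using assms(2) by (simp add: halted_def)
  then have step: "step P c = exec ?i c" using assms(2) by (simp add: step_def)
  have pcd: "pc d = l + 2 * pc c" using sim pc by (simp add: simulates_def)
  have len: "length P' \<ge> l + 2 * length P"
    using P' by (simp add: length_shift_program)
  have at: "P' ! (l + 2 * pc c) = shift_instr l (length P) ?i ! 0"
      "P' ! Suc (l + 2 * pc c) = shift_instr l (length P) ?i ! 1"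
    using nth_shift_program[OF pc, of l] P' pc
    by (auto simp: nth_append length_shift_program simp flip: add_Suc_right)
  let ?d1 = "exec (P' ! pc d) d" let ?d2 = "exec (P' ! pc ?d1) ?d1"
  have reg: "regs d (i + 20) = regs c i" "regs d (20 + i) = regs c i" for i
    using sim by (auto simp: simulates_def add.commute)
  have base: "regs d 1 = base" "regs d (Suc 0) = base"
    using sim by (auto simp: simulates_def)
  have mem: "mem d (base + a) = mem c a" "mem d (a + base) = mem c a" for a
    using sim by (auto simp: simulates_def add.commute)
  have le: "regs c i \<le> B" "mem c a \<le> B" for i a
    using words(1) by (auto simp: words_le_def)
  have le': "regs d i \<le> B + base" "mem d a \<le> B + base" for i a
    using words(3) by (auto simp: words_le_def)
  \<comment> \<open>The value written is a word of the next simulated configuration, which bounds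
    the result of any operation at once.\<close>
  have leS: "regs (exec ?i c) i \<le> B" for i
    using words(2) step by (auto simp: words_le_def)
  have d1: "pc ?d1 = Suc (l + 2 * pc c)"
    using at pcd by (cases ?i) auto
  have "words_le (B + base) ?d1 \<and> words_le (B + base) ?d2 \<and> simulates l (length P) base ?d2 (exec ?i c)"
  proof (cases ?i)
    case (Const i n)
    have "n \<le> B" using leS[of i] Const by simp
    then show ?thesis
      using Const at d1 pcd pc reg base mem le'
      by (auto simp: words_le_def simulates_def intro: order_trans trans_le_add1)
  next
    case (Op b i j k)
    have "apply_binop b (regs c j) (regs c k) \<le> B" using leS[of i] Op by simp
    then show ?thesis
      using Op at d1 pcd pc reg base mem le'
      by (auto simp: words_le_def simulates_def intro: order_trans trans_le_add1)
  next
    case (Load i j)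
    then show ?thesis
      using at d1 pcd pc reg base mem le' le
      by (auto simp: words_le_def simulates_def intro: order_trans trans_le_add1)
  next
    case (Store i j)
    then show ?thesis
      using at d1 pcd pc reg base mem le' le
      by (auto simp: words_le_def simulates_def intro: order_trans trans_le_add1)
  next
    case (Jump_zero i j)
    then show ?thesis
      using at d1 pcd pc reg base mem le' le
      by (auto simp: words_le_def simulates_def intro: order_trans trans_le_add1)
  qed
  moreover have "\<not> halted P' d" "\<not> halted P' ?d1"
    using pcd d1 pc len by (auto simp: halted_def)
  ultimately have "runs P' (B + base) d (Suc (Suc 0)) ?d2" "simulates l (length P) base ?d2 (step P c)"
    using words(3) step by (auto intro!: runs_Suc runs_0)
  then show ?thesis
    by (intro exI[of _ ?d2]) (simp add: numeral_2_eq_2)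
qed

lemma simulates_runs:
  assumes "runs P B c t c'" and "simulates l (length P) base d c" and "words_le (B + base) d"
    and "P' = us @ shift_program P l @ vs" and "length us = l"
  shows "\<exists>d'. runs P' (B + base) d (2 * t) d' \<and> simulates l (length P) base d' c'"
proof -
  have "\<exists>d'. runs P' (B + base) d (2 * s) d' \<and> simulates l (length P) base d' ((step P ^^ s) c)"
    if "s \<le> t" for s
    using that
  proof (induction s)
    case 0
    then show ?case using assms(2,3) by (auto intro: runs_0)
  next
    case (Suc s)
    then obtain d' where d': "runs P' (B + base) d (2 * s) d'"
        "simulates l (length P) base d' ((step P ^^ s) c)" by auto
    have "\<not> halted P ((step P ^^ s) c)" "words_le B ((step P ^^ s) c)" "words_le B ((step P ^^ Suc s) c)"
      using assms(1) Suc.prems by (auto simp: runs_def simp del: funpow.simps)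
    with simulates_step[OF d'(2) _ _ _ _ assms(4,5), of B] runs_final_words_le[OF d'(1)]
    obtain d'' where d'': "runs P' (B + base) d' 2 d''"
        "simulates l (length P) base d'' ((step P ^^ Suc s) c)" by auto
    from runs_trans[OF d'(1) d''(1)] d''(2) show ?case
      by (intro exI[of _ d'']) (simp add: add.commute)
  qed
  from this[of t] assms(1) show ?thesis by (auto simp: runs_def)
qed


section \<open>The reduction as a RAM program\<close>

text \<open>Memory is viewed as a list growing at its end: the next free address is the length, so
  storing there appends.\<close>

definition memory :: "nat list \<Rightarrow> nat \<Rightarrow> nat" where
  "memory ys a = (if a < length ys then ys ! a else 0)"

lemma memory_append: "(memory ys)(length ys := v) = memory (ys @ [v])"
  by (auto simp: memory_def fun_eq_iff nth_append)

lemma memory_drop: "drop p ys = u # us \<Longrightarrow> memory ys p = u"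
  by (metis drop_eq_Nil2 hd_drop_conv_nth leI list.distinct(1) list.sel(1) memory_def)

text \<open>
  Registers of the reduction: 0 address of the next output word, 1 address of the matching instance,
  2 the number 1, 3 the number 0, 4 \<open>h\<close>, 5 \<open>N = 2\<^sup>h\<close>, 6 number \<open>M\<close> of clauses, 7 \<open>N (M + 1)\<close>,
  8 to 10 loop counters for assignments, clauses, literals, 11 address of the next input word,
  12 bit of the current clause, 13 and 14 temporary, 15 values and 18 mask for \<open>lit_bit\<close>,
  16 next state of the automaton, 17 factor that shifts values to the current half, 19 temporary
  during the simulation, 20 and above registers of the simulated program.
\<close>

definition lit_code :: "instr list" where
  "lit_code = [Load 13 11, Op Add 11 11 2, Op Shr 14 13 2, Op And 13 13 2, Op Sub 13 2 13,
     Op Mul 13 13 18, Op Xor 13 13 15, Op Shr 13 13 14, Op And 13 13 2, Op Sub 12 12 13]"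

lemma straight_lit_code:
  assumes "memory ys (R 11) = l" and "R 2 = 1" and "R 15 + R 18 + l + 1 \<le> B" and "R 11 < B" and "R 12 \<le> B"
  shows "straight B lit_code (\<lambda>R' m'. m' = memory ys \<and> (\<forall>r. r \<notin> {11, 12, 13, 14} \<longrightarrow> R' r = R r) \<and>
      R' 11 = Suc (R 11) \<and> R' 12 = R 12 - lit_bit (R 15) (R 18) l) R (memory ys)"
proof -
  have d: "drop_bit k x \<le> x" for k x :: nat
    by (simp add: drop_bit_eq_div)
  \<comment> \<open>The factor is 0 or 1, so the XOR is at most mask plus values; this is the source
    of the sum in the assumption on \<open>B\<close>.\<close>
  have x: "semiring_bit_operations_class.xor ((1 - y) * R 18) (R 15) \<le> B" for y
  proof -
    have "(1 - y) * R 18 \<le> R 18" by (cases y) auto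
    with xor_le_add[of "(1 - y) * R 18" "R 15"] assms(3) show ?thesis by linarith
  qed
  have "(1 - y) * R 18 \<le> B" for y
    using assms(3) by (cases y) auto
  moreover have "drop_bit k (semiring_bit_operations_class.xor ((1 - y) * R 18) (R 15)) \<le> B" for k y
    using d x order_trans by blast
  moreover have "drop_bit k l \<le> B" for k
    using d[of k l] assms(3) by linarith
  moreover have "z mod 2 \<le> B" for z
    using assms(3) mod_less_divisor[of 2 z] by linarith
  moreover have "R 12 - z \<le> B" "1 - z \<le> B" for z
    using assms(3,5) by linarith+
  ultimately show ?thesis
    using x assms by (simp add: lit_code_def lit_bit_def and_one_eq)
qed

definition clause_code :: code where
  "clause_code = (\<lambda>_. [Load 10 11, Op Add 11 11 2, Const 12 1]) ;; repeat_code 10 (\<lambda>_. lit_code)"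

text \<open>Ten instructions and three steps of loop overhead per literal make 13; three
  instructions of preparation and the last test make 4.\<close>

lemma reaches_clause_code:
  assumes "drop (R 11) ys = (length ls # ls) @ us" and "R 2 = 1" and "R 3 = 0" and "length ys \<le> B"
    and "\<And>l. l \<in> set ls \<Longrightarrow> R 15 + R 18 + l + 1 \<le> B"
    and Q: "\<And>R'. (\<forall>r. r \<notin> {10, 11, 12, 13, 14} \<longrightarrow> R' r = R r) \<Longrightarrow> R' 11 = R 11 + Suc (length ls) \<Longrightarrow>
      R' 12 = clause_bit (R 15) (R 18) ls \<Longrightarrow> Q R' (memory ys)"
  shows "reaches B clause_code (13 * length ls + 4) Q R (memory ys)"
proof -
  let ?n = "length ls"
  have "R 11 < length ys"
    using assms(1) by (metis append_Cons drop_eq_Nil2 leI list.distinct(1))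
  then have len: "R 11 + Suc ?n \<le> length ys"
    using arg_cong[OF assms(1), of length] by simp
  have lit: "memory ys (R 11 + Suc i) = ls ! i" if "i < ?n" for i
  proof -
    have "memory ys (R 11 + Suc i) = drop (R 11) ys ! Suc i"
      using len that by (simp add: memory_def)
    then show ?thesis using that by (simp add: assms(1) nth_append)
  qed
  define Inv where "Inv i R' m' \<longleftrightarrow> m' = memory ys \<and> (\<forall>r. r \<notin> {10, 11, 12, 13, 14} \<longrightarrow> R' r = R r) \<and>
      R' 11 = R 11 + Suc i \<and> R' 12 = clause_bit (R 15) (R 18) (take i ls)" for i R' m'
  have "reaches B (repeat_code 10 (\<lambda>_. lit_code)) (?n * (length lit_code + 3) + 1) Q R' m'"
    if init: "Inv 0 R' m'" "R' 10 = ?n" for R' m'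
  proof (rule reaches_repeat[where Inv = Inv])
    fix i R' m'
    assume i: "i < ?n" and inv: "Inv i R' m'" and r: "R' 10 = ?n - i"
    have m': "m' = memory ys"
      using inv by (simp add: Inv_def)
    have B: "R 15 + R 18 + ls ! i + 1 \<le> B"
      using assms(5) i by simp
    \<comment> \<open>Truncated subtraction acts as a conjunction: register 12 starts at 1, drops to
      0 at the first true literal and stays there.\<close>
    have bit: "clause_bit (R 15) (R 18) (take i ls) - lit_bit (R 15) (R 18) (ls ! i) =
        clause_bit (R 15) (R 18) (take (Suc i) ls)"
      using i by (auto simp: clause_bit_def take_Suc_conv_app_nth lit_bit_def and_one_eq)
    have "straight B lit_code (\<lambda>R'' m''. m'' = memory ys \<and>
        (\<forall>r. r \<notin> {11, 12, 13, 14} \<longrightarrow> R'' r = R' r) \<and> R'' 11 = Suc (R' 11) \<and>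
        R'' 12 = R' 12 - lit_bit (R' 15) (R' 18) (ls ! i)) R' (memory ys)"
      using inv lit[OF i] assms(2) B len i assms(4)
      by (intro straight_lit_code) (auto simp: Inv_def clause_bit_def)
    then have "straight B lit_code (\<lambda>R'' m''. R'' 10 = ?n - i \<and> R'' 2 = 1 \<and> R'' 3 = 0 \<and>
        Inv (Suc i) (R''(10 := ?n - Suc i)) m'') R' m'"
      unfolding m'
      by (rule straight_mono) (use inv r bit assms(2,3) in \<open>auto simp: Inv_def\<close>)
    then show "reaches B (\<lambda>_. lit_code) (length lit_code) (\<lambda>R'' m''. R'' 10 = ?n - i \<and> R'' 2 = 1 \<and>
        R'' 3 = 0 \<and> Inv (Suc i) (R''(10 := ?n - Suc i)) m'') R' m'"
      by (rule reaches_straight)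
  next
    fix R' m'
    assume "Inv ?n R' m'"
    then show "Q R' m'"
      using Q[of R'] by (auto simp: Inv_def)
  qed (use init in auto)
  moreover have "memory ys (R 11) = ?n"
    using memory_drop[of "R 11" ys ?n] assms(1) by simp
  moreover have "?n \<le> B" "1 \<le> B" "Suc (R 11) \<le> B"
    using len assms(4) by auto
  ultimately have "reaches B (\<lambda>_. [Load 10 11, Op Add 11 11 2, Const 12 1]) 3
      (reaches B (repeat_code 10 (\<lambda>_. lit_code)) (?n * (length lit_code + 3) + 1) Q) R (memory ys)"
    using assms(2) by (intro reaches_straight_le) (simp_all add: Inv_def clause_bit_def)
  from reaches_seq[OF this] show ?thesis
    unfolding clause_code_def by (rule reaches_mono) (auto simp: lit_code_def)
qed

text \<open>\<open>f p v\<close> is what the instructions write when \<open>p\<close> is the next state of the automaton and \<open>v\<close> the bit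
  of the current clause.\<close>

definition emits :: "nat \<Rightarrow> instr list \<Rightarrow> nat \<Rightarrow> (nat \<Rightarrow> nat \<Rightarrow> nat list) \<Rightarrow> bool" where
  "emits B is e f \<longleftrightarrow> (\<forall>p v. length (f p v) \<le> 6) \<and>
     (\<forall>R ys. R 0 = length ys \<longrightarrow> R 2 = 1 \<longrightarrow> R 3 = 0 \<longrightarrow> R 12 \<le> 1 \<longrightarrow> length ys + 6 \<le> B \<longrightarrow> R 16 + 3 \<le> B \<longrightarrow>
       straight B is (\<lambda>R' m'. m' = memory (ys @ f (R 16) (R 12)) \<and>
         (\<forall>r. r \<notin> {0, 13, 14, 16} \<longrightarrow> R' r = R r) \<and>
         R' 0 = length ys + length (f (R 16) (R 12)) \<and> R' 16 = R 16 + e) R (memory ys))"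

lemma straight_emits:
  assumes "emits B is e f" and "R 0 = length ys" and "R 2 = 1" and "R 3 = 0" and "R 12 \<le> 1"
    and "length ys + 6 \<le> B" and "R 16 + 3 \<le> B"
    and "\<And>R'. (\<forall>r. r \<notin> {0, 13, 14, 16} \<longrightarrow> R' r = R r) \<Longrightarrow>
         R' 0 = length ys + length (f (R 16) (R 12)) \<Longrightarrow> R' 16 = R 16 + e \<Longrightarrow>
         Q R' (memory (ys @ f (R 16) (R 12)))"
  shows "straight B is Q R (memory ys)"
proof -
  have "straight B is (\<lambda>R' m'. m' = memory (ys @ f (R 16) (R 12)) \<and>
         (\<forall>r. r \<notin> {0, 13, 14, 16} \<longrightarrow> R' r = R r) \<and>
         R' 0 = length ys + length (f (R 16) (R 12)) \<and> R' 16 = R 16 + e) R (memory ys)"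
    using assms(1-7) unfolding emits_def by blast
  then show ?thesis
    by (rule straight_mono) (use assms(8) in blast)
qed

section \<open>Loops over clauses and over assignments\<close>

lemma length_concat_upt_le:
  assumes "\<And>i. length (g i) \<le> k"
  shows "length (concat (map g [0..<j])) \<le> k * j"
proof (induction j)
  case (Suc j)
  then show ?case using assms[of j] by simp
qed simp

definition clause_words :: "nat list list \<Rightarrow> nat list" where
  "clause_words cs = concat (map (\<lambda>c. length c # c) cs)"

text \<open>\<open>e\<close> is the number of automaton states consumed per clause: 0 while the word
  is written and 1 while gadgets are, so that one loop serves both.\<close>

definition clauses_out :: "(nat \<Rightarrow> nat \<Rightarrow> nat list) \<Rightarrow> nat \<Rightarrow> nat list list \<Rightarrow> nat \<Rightarrow> nat \<Rightarrow> nat \<Rightarrow> nat \<Rightarrow> nat list" where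
  "clauses_out f e cs pos msk p j = concat (map (\<lambda>i. f (p + e * i) (clause_bit pos msk (cs ! i))) [0..<j])"

lemma length_clauses_out_le:
  assumes "\<And>p v. length (f p v) \<le> 6"
  shows "length (clauses_out f e cs pos msk p j) \<le> 6 * j"
  unfolding clauses_out_def by (intro length_concat_upt_le assms)

definition clauses_code :: "instr list \<Rightarrow> code" where
  "clauses_code em = repeat_code 9 (clause_code ;; (\<lambda>_. em))"

lemma reaches_clauses_code:
  assumes em: "emits B em e f"
    and ys: "ys = n # k # clause_words cs @ out"
    and R: "R 0 = length ys" "R 2 = 1" "R 3 = 0" "R 9 = length cs" "R 11 = 2" "R 12 \<le> 1"
    and len: "\<And>c. c \<in> set cs \<Longrightarrow> length c \<le> L"
    and B: "length ys + 6 * length cs + 6 \<le> B" "R 16 + e * length cs + 3 \<le> B"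
      "\<And>c l. c \<in> set cs \<Longrightarrow> l \<in> set c \<Longrightarrow> R 15 + R 18 + l + 1 \<le> B"
    and Q: "\<And>R'. (\<forall>r. r \<notin> {0, 9, 10, 11, 12, 13, 14, 16} \<longrightarrow> R' r = R r) \<Longrightarrow> R' 12 \<le> 1 \<Longrightarrow>
      R' 16 = R 16 + e * length cs \<Longrightarrow>
      R' 0 = length (ys @ clauses_out f e cs (R 15) (R 18) (R 16) (length cs)) \<Longrightarrow>
      Q R' (memory (ys @ clauses_out f e cs (R 15) (R 18) (R 16) (length cs)))"
  shows "reaches B (clauses_code em) (length cs * (13 * L + length em + 7) + 1) Q R (memory ys)"
proof -
  let ?M = "length cs"
  let ?o = "clauses_out f e cs (R 15) (R 18) (R 16)"
  \<comment> \<open>The 2 skips the words for \<open>n\<close> and the number of clauses.\<close>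
  define Inv where "Inv j R' m' \<longleftrightarrow> m' = memory (ys @ ?o j) \<and>
      (\<forall>r. r \<notin> {0, 9, 10, 11, 12, 13, 14, 16} \<longrightarrow> R' r = R r) \<and> R' 0 = length (ys @ ?o j) \<and>
      R' 11 = 2 + length (clause_words (take j cs)) \<and> R' 12 \<le> 1 \<and> R' 16 = R 16 + e * j" for j R' m'
  have o_len: "length (?o j) \<le> 6 * j" for j
    using em by (intro length_clauses_out_le) (simp add: emits_def)
  have "reaches B (clauses_code em) (?M * ((13 * L + 4 + length em) + 3) + 1) Q R (memory ys)"
    unfolding clauses_code_def
  proof (rule reaches_repeat[where Inv = Inv])
    fix j R' m'
    assume j: "j < ?M" and inv: "Inv j R' m'" and r: "R' 9 = ?M - j"
    define c where "c = cs ! j"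
    have c: "c \<in> set cs" using j by (simp add: c_def)
    have take_Suc: "take (Suc j) cs = take j cs @ [c]"
      using j by (simp add: c_def take_Suc_conv_app_nth)
    have "cs = take j cs @ c # drop (Suc j) cs"
      using j unfolding c_def by (rule id_take_nth_drop)
    then have "clause_words cs = clause_words (take j cs) @ (length c # c) @ clause_words (drop (Suc j) cs)"
      by (metis (no_types, lifting) clause_words_def concat.simps(2) concat_append list.simps(9) map_append)
    \<comment> \<open>Output is appended behind the input, so it only lengthens the tail after the
      clause being read.\<close>
    then have drop: "drop (R' 11) (ys @ ?o j) = (length c # c) @ clause_words (drop (Suc j) cs) @ out @ ?o j"
      using inv ys by (simp add: Inv_def)
    have o_Suc: "?o (Suc j) = ?o j @ f (R 16 + e * j) (clause_bit (R 15) (R 18) c)"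
      by (simp add: clauses_out_def c_def)
    have bound: "length (ys @ ?o j) + 6 \<le> B" "R 16 + e * j + 3 \<le> B"
    proof -
      show "length (ys @ ?o j) + 6 \<le> B"
        using o_len[of j] B(1) j by simp
      have "e * j \<le> e * ?M" using j by simp
      then show "R 16 + e * j + 3 \<le> B" using B(2) by linarith
    qed
    have "reaches B clause_code (13 * length c + 4) (reaches B (\<lambda>_. em) (length em)
        (\<lambda>R' m'. R' 9 = ?M - j \<and> R' 2 = 1 \<and> R' 3 = 0 \<and> Inv (Suc j) (R'(9 := ?M - Suc j)) m'))
        R' (memory (ys @ ?o j))"
    proof (rule reaches_clause_code[where R = R', OF drop], goal_cases)
      case (5 R'')
      have eq: "clause_bit (R' 15) (R' 18) c = clause_bit (R 15) (R 18) c"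
        using inv by (simp add: Inv_def)
      have bit: "clause_bit (R 15) (R 18) c \<le> 1" by (simp add: clause_bit_def)
      show ?case
      proof (intro reaches_straight straight_emits[OF em], goal_cases)
        case (7 R3)
        have "R3 16 = R 16 + e * Suc j"
          using 7(3) 5(1) inv by (simp add: Inv_def)
        moreover have "R'' 12 = clause_bit (R 15) (R 18) c" "R'' 16 = R 16 + e * j"
          using 5 eq inv by (auto simp: Inv_def)
        ultimately show ?case
          using 7(1,2) 5 eq inv r R(2,3) bit
          by (auto simp: Inv_def o_Suc take_Suc clause_words_def)
      qed (use 5 eq bit inv bound R(2,3) in \<open>auto simp: Inv_def\<close>)
    qed (use inv bound R(2,3) B(3)[OF c] in \<open>auto simp: Inv_def\<close>)
    then have "reaches B (clause_code ;; (\<lambda>_. em)) (13 * length c + 4 + length em)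
        (\<lambda>R' m'. R' 9 = ?M - j \<and> R' 2 = 1 \<and> R' 3 = 0 \<and> Inv (Suc j) (R'(9 := ?M - Suc j)) m')
        R' (memory (ys @ ?o j))"
      by (rule reaches_seq)
    moreover have "m' = memory (ys @ ?o j)"
      using inv by (simp add: Inv_def)
    ultimately show "reaches B (clause_code ;; (\<lambda>_. em)) (13 * L + 4 + length em)
        (\<lambda>R' m'. R' 9 = ?M - j \<and> R' 2 = 1 \<and> R' 3 = 0 \<and> Inv (Suc j) (R'(9 := ?M - Suc j)) m') R' m'"
      using len[OF c] by (auto elim!: reaches_mono)
  next
    show "Inv 0 R (memory ys)"
      using R by (simp add: Inv_def clauses_out_def clause_words_def)
  next
    fix R' m'
    assume "Inv ?M R' m'"
    then show "Q R' m'"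
      using Q[of R'] by (auto simp: Inv_def)
  qed (use R in auto)
  then show ?thesis
    by (rule reaches_mono) (simp_all add: algebra_simps)
qed

text \<open>Common form of word and automaton, with one row per assignment \<open>x\<close>. A row
  uses \<open>e * (length cs + 1)\<close> states, the last \<open>e\<close> for its tail;
  \<open>F\<close> moves \<open>x\<close> to its half.\<close>

definition sweep_out :: "(nat \<Rightarrow> nat list) \<Rightarrow> (nat \<Rightarrow> nat \<Rightarrow> nat list) \<Rightarrow> (nat \<Rightarrow> nat list) \<Rightarrow> nat \<Rightarrow>
    nat list list \<Rightarrow> nat \<Rightarrow> nat \<Rightarrow> nat \<Rightarrow> nat \<Rightarrow> nat list" where
  "sweep_out hf f tf e cs F msk p N = concat (map (\<lambda>x.
     let q = p + x * (e * (length cs + 1))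
     in hf q @ clauses_out f e cs (x * F) msk q (length cs) @ tf (q + e * length cs)) [0..<N])"

lemma length_sweep_out_le:
  assumes "\<And>p. length (hf p) \<le> 6" and "\<And>p v. length (f p v) \<le> 6" and "\<And>p. length (tf p) \<le> 6"
  shows "length (sweep_out hf f tf e cs F msk p N) \<le> (6 * length cs + 12) * N"
  unfolding sweep_out_def Let_def
proof (rule length_concat_upt_le)
  fix x
  let ?q = "p + x * (e * (length cs + 1))"
  show "length (hf ?q @ clauses_out f e cs (x * F) msk ?q (length cs) @ tf (?q + e * length cs))
      \<le> 6 * length cs + 12"
    using assms(1)[of ?q] assms(3)[of "?q + e * length cs"]
      length_clauses_out_le[of f e cs "x * F" msk ?q "length cs", OF assms(2)] by simp
qed

text \<open>Adding register 3 copies a register, as it contains 0. Register 15 advances by register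
  17 and thus runs through the multiples \<open>x * F\<close>.\<close>

definition sweep_code :: "instr list \<Rightarrow> instr list \<Rightarrow> instr list \<Rightarrow> code" where
  "sweep_code hc em tc = (\<lambda>_. [Const 15 0, Op Add 8 5 3]) ;;
     repeat_code 8 ((\<lambda>_. hc @ [Const 11 2, Op Add 9 6 3]) ;; clauses_code em ;;
       (\<lambda>_. tc @ [Op Add 15 15 17]))"

lemma reaches_sweep_code:
  assumes hc: "emits B hc 0 (\<lambda>p v. hf p)" and em: "emits B em e f" and tc: "emits B tc e (\<lambda>p v. tf p)"
    and ys: "ys = n # k # clause_words cs @ out"
    and R: "R 0 = length ys" "R 2 = 1" "R 3 = 0" "R 5 = N" "R 6 = length cs" "R 12 \<le> 1"
    and len: "\<And>c. c \<in> set cs \<Longrightarrow> length c \<le> L"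
    and B: "length ys + N * (6 * length cs + 12) + 6 \<le> B" "R 16 + N * (e * (length cs + 1)) + 3 \<le> B"
      "\<And>c l. c \<in> set cs \<Longrightarrow> l \<in> set c \<Longrightarrow> N * R 17 + R 18 + l + 1 \<le> B"
      "N * R 17 \<le> B" "N \<le> B" "length cs \<le> B"
    and Q: "\<And>R'. (\<forall>r. r \<notin> {0, 8, 9, 10, 11, 12, 13, 14, 15, 16} \<longrightarrow> R' r = R r) \<Longrightarrow> R' 12 \<le> 1 \<Longrightarrow>
      R' 0 = length (ys @ sweep_out hf f tf e cs (R 17) (R 18) (R 16) N) \<Longrightarrow>
      Q R' (memory (ys @ sweep_out hf f tf e cs (R 17) (R 18) (R 16) N))"
  shows "reaches B (sweep_code hc em tc)
    (N * (length cs * (13 * L + length em + 7) + length hc + length tc + 7) + 3) Q R (memory ys)"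
proof -
  let ?M = "length cs"
  let ?o = "sweep_out hf f tf e cs (R 17) (R 18) (R 16)"
  let ?T = "length cs * (13 * L + length em + 7) + 1"
  define D where "D = e * (?M + 1)"
  define Inv where "Inv x R' m' \<longleftrightarrow> m' = memory (ys @ ?o x) \<and>
      (\<forall>r. r \<notin> {0, 8, 9, 10, 11, 12, 13, 14, 15, 16} \<longrightarrow> R' r = R r) \<and> R' 0 = length (ys @ ?o x) \<and>
      R' 12 \<le> 1 \<and> R' 15 = x * R 17 \<and> R' 16 = R 16 + x * D" for x R' m'
  let ?row = "\<lambda>x. hf (R 16 + x * D) @ clauses_out f e cs (x * R 17) (R 18) (R 16 + x * D) ?M @
      tf (R 16 + x * D + e * ?M)"
  have lens: "length (hf p) \<le> 6" "length (f p v) \<le> 6" "length (tf p) \<le> 6" for p v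
    using hc em tc by (auto simp: emits_def)
  have c_len: "length (clauses_out f e cs pos msk p ?M) \<le> 6 * ?M" for pos msk p
    by (intro length_clauses_out_le lens)
  have o: "?o x = concat (map ?row [0..<x])" for x
    by (simp add: sweep_out_def Let_def D_def)
  have o_Suc: "?o (Suc x) = ?o x @ ?row x" for x
    by (simp add: o)
  have o_len: "length (?o x) \<le> (6 * ?M + 12) * x" for x
    by (intro length_sweep_out_le lens)
  have loop: "reaches B (repeat_code 8 ((\<lambda>_. hc @ [Const 11 2, Op Add 9 6 3]) ;; clauses_code em ;;
       (\<lambda>_. tc @ [Op Add 15 15 17])))
      (N * ((length hc + 2 + (?T + (length tc + 1))) + 3) + 1) Q R' (memory ys)"
    if init: "Inv 0 R' (memory ys)" "R' 8 = N" for R'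
  proof (rule reaches_repeat[where Inv = Inv])
    fix x R' m'
    assume x: "x < N" and inv: "Inv x R' m'" and r: "R' 8 = N - x"
    let ?Q = "\<lambda>R' m'. R' 8 = N - x \<and> R' 2 = 1 \<and> R' 3 = 0 \<and> Inv (Suc x) (R'(8 := N - Suc x)) m'"
    have m': "m' = memory (ys @ ?o x)" using inv by (simp add: Inv_def)
    \<comment> \<open>Comparing pass \<open>Suc x\<close> with \<open>N\<close> makes the products
      linear facts. Register 15 ends at \<open>N * R 17\<close>, one step beyond the last value
      used.\<close>
    have "Suc x * (6 * ?M + 12) \<le> N * (6 * ?M + 12)" "Suc x * D \<le> N * D" "Suc x * R 17 \<le> N * R 17"
      using x by (intro mult_right_mono; simp)+
    then have bounds: "length (ys @ ?o x) + 6 * ?M + 18 \<le> B" "R 16 + x * D + e * ?M + 3 \<le> B"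
        "x * R 17 + R 17 \<le> B"
      using o_len[of x] B(1,2,4) by (auto simp: D_def algebra_simps)
    have pos: "x * R 17 \<le> N * R 17"
      using x by simp
    have lit: "x * R 17 + R 18 + l + 1 \<le> B" if "c \<in> set cs" "l \<in> set c" for c l
      using B(3)[OF that] pos by linarith
    have hd_len: "length (hf (R 16 + x * D)) \<le> 6" by (rule lens)
    show "reaches B ((\<lambda>_. hc @ [Const 11 2, Op Add 9 6 3]) ;; clauses_code em ;; (\<lambda>_. tc @ [Op Add 15 15 17]))
        (length hc + 2 + (?T + (length tc + 1))) ?Q R' m'"
      unfolding m'
    proof (intro reaches_seq reaches_straight_le, unfold straight_append, rule straight_emits[OF hc], goal_cases)
      case (7 R1)
      let ?ys1 = "ys @ ?o x @ hf (R 16 + x * D)"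
      have R1: "R1 16 = R 16 + x * D" "R1 0 = length ?ys1" "R1 8 = N - x" "R1 15 = x * R 17" "R1 12 \<le> 1"
          "\<And>i. i \<in> {2, 3, 5, 6, 17, 18} \<Longrightarrow> R1 i = R i"
        using 7 inv r by (auto simp: Inv_def)
      have R1_frame: "R1 i = R' i" if "i \<notin> {0, 13, 14, 16}" for i
        using 7(1) that by blast
      let ?R2 = "R1(11 := 2, 9 := ?M)"
      have "reaches B (clauses_code em) ?T (reaches B (\<lambda>_. tc @ [Op Add 15 15 17]) (length tc + 1) ?Q)
          ?R2 (memory ?ys1)"
      proof (rule reaches_clauses_code[OF em, where n = n and k = k], goal_cases)
        case (12 R3)
        let ?ys3 = "?ys1 @ clauses_out f e cs (x * R 17) (R 18) (R 16 + x * D) ?M"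
        have R3: "R3 16 = R 16 + x * D + e * ?M" "R3 0 = length ?ys3" "R3 8 = N - x" "R3 12 \<le> 1"
            "R3 15 = x * R 17" "\<And>i. i \<in> {2, 3, 5, 6, 17, 18} \<Longrightarrow> R3 i = R i"
          using 12 R1 by auto
        have ys3: "length ?ys3 + 6 \<le> B"
          using hd_len c_len[of "x * R 17" "R 18" "R 16 + x * D"] bounds by simp
        have "straight B (tc @ [Op Add 15 15 17]) ?Q R3 (memory ?ys3)"
          unfolding straight_append
        proof (rule straight_emits[OF tc], goal_cases)
          case (7 R4)
          have R4: "R4 0 = length (?ys3 @ tf (R 16 + x * D + e * ?M))" "R4 16 = R 16 + Suc x * D"
            using 7 R3 by (auto simp: D_def)
          have R4_frame: "R4 i = R i" if "i \<notin> {0, 8, 9, 10, 11, 12, 13, 14, 15, 16}" for i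
          proof -
            have "R4 i = R3 i" "R3 i = R1 i" "R1 i = R' i" "R' i = R i"
              using that 7(1) 12(1) R1_frame inv by (auto simp: Inv_def)
            then show ?thesis by simp
          qed
          then show ?case
            using 7(1) R4 R3 bounds R(2,3) r by (auto simp: Inv_def o_Suc)
        qed (use R3 R(2,3) bounds(2) ys3 in auto)
        then show ?case
          using R1 by (intro reaches_straight_le) auto
      qed (use R1 R ys len bounds hd_len lit in auto)
      then have "reaches B (clauses_code em ;; (\<lambda>_. tc @ [Op Add 15 15 17])) (?T + (length tc + 1)) ?Q
          ?R2 (memory ?ys1)"
        by (rule reaches_seq)
      moreover have "R' 16 = R 16 + x * D" "R1 6 = ?M" "R1 3 = 0"
        using inv R1(6) R(3,5) by (simp_all add: Inv_def)
      ultimately show ?case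
        using B(6) bounds(1) by simp
    qed (use inv R bounds in \<open>auto simp: Inv_def\<close>)
  next
    fix R' m'
    assume "Inv N R' m'"
    then show "Q R' m'"
      using Q[of R'] by (auto simp: Inv_def)
  qed (use init in auto)
  have "Inv 0 (R(15 := 0, 8 := N)) (memory ys)"
    using R by (simp add: Inv_def sweep_out_def)
  then have "reaches B (\<lambda>_. [Const 15 0, Op Add 8 5 3]) 2
      (reaches B (repeat_code 8 ((\<lambda>_. hc @ [Const 11 2, Op Add 9 6 3]) ;; clauses_code em ;;
        (\<lambda>_. tc @ [Op Add 15 15 17])))
      (N * ((length hc + 2 + (?T + (length tc + 1))) + 3) + 1) Q) R (memory ys)"
    using loop[of "R(15 := 0, 8 := N)"] R B by (intro reaches_straight_le) simp_all
  from reaches_seq[OF this] show ?thesis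
    unfolding sweep_code_def by (rule reaches_mono) (simp_all add: algebra_simps)
qed

section \<open>Instructions that write constants and transitions\<close>

definition emit :: "nat \<Rightarrow> instr list" where
  "emit r = [Store 0 r, Op Add 0 0 2]"

definition emit_consts :: "nat list \<Rightarrow> instr list" where
  "emit_consts us = concat (map (\<lambda>u. Const 13 u # emit 13) us)"

lemma straight_emit_consts:
  assumes "R 0 = length ys" and "R 2 = 1" and "length ys + length us \<le> B" and "\<forall>u\<in>set us. u \<le> B"
    and "\<And>R'. (\<forall>r. r \<notin> {0, 13} \<longrightarrow> R' r = R r) \<Longrightarrow> R' 0 = length (ys @ us) \<Longrightarrow> Q R' (memory (ys @ us))"
  shows "straight B (emit_consts us) Q R (memory ys)"
  using assms
proof (induction us arbitrary: R ys)
  case Nil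
  then show ?case by (simp add: emit_consts_def)
next
  case (Cons u us)
  have "straight B (emit_consts us) Q (R(13 := u, 0 := Suc (length ys))) (memory (ys @ [u]))"
  proof (rule Cons.IH)
    fix R'
    assume *: "\<forall>r. r \<notin> {0, 13} \<longrightarrow> R' r = (R(13 := u, 0 := Suc (length ys))) r"
      "R' 0 = length ((ys @ [u]) @ us)"
    then show "Q R' (memory ((ys @ [u]) @ us))"
      using Cons.prems(5)[of R'] by simp
  qed (use Cons.prems in auto)
  then show ?case
    using Cons.prems by (simp add: emit_consts_def emit_def memory_append)
qed

lemma memory_append_length: "n = length ys \<Longrightarrow> (memory ys)(n := v) = memory (ys @ [v])"
  by (simp add: memory_append)

lemma emits_word_head: "2 \<le> B \<Longrightarrow> emits B (emit_consts [2]) 0 (\<lambda>p v. [2])"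
  by (simp add: emits_def emit_consts_def emit_def memory_append)

lemma emits_word_bit: "emits B (emit 12) 0 (\<lambda>p v. [v])"
  by (simp add: emits_def emit_def memory_append)

lemma emits_word_tail: "emits B [] 0 (\<lambda>p v. [])"
  by (simp add: emits_def)

text \<open>Labels are written encoded, as 0 or the successor of the letter: 3 for the opening
  letter 2, and in a step 1 and \<open>2 + v\<close> for the letters 0 and \<open>1 + v\<close>. The
  tail advances the state once more, past the last one of the gadget.\<close>

definition gadget_head :: "instr list" where
  "gadget_head = emit_consts [1, 3] @ emit 16"

definition gadget_step :: "instr list" where
  "gadget_step = emit 16 @ emit_consts [1] @ Op Add 14 16 2 # emit 14 @ emit 16 @
     [Const 13 2, Op Add 13 13 12] @ emit 13 @ emit 14 @ [Op Add 16 16 2]"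

definition gadget_tail :: "instr list" where
  "gadget_tail = emit 16 @ emit 3 @ emit_consts [2] @ [Op Add 16 16 2]"

lemma emits_gadget_head: "3 \<le> B \<Longrightarrow> emits B gadget_head 0 (\<lambda>p v. [1, 3, p])"
  by (simp add: emits_def gadget_head_def emit_consts_def emit_def memory_append_length)

lemma emits_gadget_step: "emits B gadget_step 1 (\<lambda>p v. [p, 1, p + 1, p, 2 + v, p + 1])"
  by (simp add: emits_def gadget_step_def emit_consts_def emit_def memory_append_length)

lemma emits_gadget_tail: "emits B gadget_tail 1 (\<lambda>p v. [p, 0, 2])"
  by (simp add: emits_def gadget_tail_def emit_consts_def emit_def memory_append_length)

lemma sweep_word:
  "sweep_out (\<lambda>p. [2]) (\<lambda>p v. [v]) (\<lambda>p. []) 0 cs F msk p N =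
     concat (map (\<lambda>x. 2 # map (clause_bit (x * F) msk) cs) [0..<N])"
proof -
  have "concat (map (\<lambda>i. [g (cs ! i)]) [0..<length cs]) = map g cs" for g :: "nat list \<Rightarrow> nat"
    by (metis (no_types, lifting) concat_map_singleton map_nth map_map comp_def map_cong)
  then show ?thesis
    by (simp add: sweep_out_def clauses_out_def Let_def)
qed

lemma sweep_gadgets:
  assumes "\<And>y. b y = map (clause_bit (y * F) msk) cs"
  shows "sweep_out (\<lambda>p. [1, 3, p]) (\<lambda>p v. [p, 1, p + 1, p, 2 + v, p + 1]) (\<lambda>p. [p, 0, 2]) 1 cs F msk 4 N =
     concat (map encode_trans (concat (map (\<lambda>y. gadget_trans (4 + y * (length cs + 1)) (b y)) [0..<N])))"
proof -
  have "concat (map (\<lambda>j. [p + j, 1, p + j + 1, p + j, 2 + clause_bit (y * F) msk (cs ! j), p + j + 1]) [0..<m]) =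
     concat (map encode_trans (concat (map (\<lambda>j. [(p + j, Some 0, p + j + 1),
       (p + j, Some (1 + b y ! j), p + j + 1)]) [0..<m])))" if "m \<le> length cs" for p y m
    using that by (induction m) (simp_all add: assms)
  then have "[1, 3, p] @ clauses_out (\<lambda>p v. [p, 1, p + 1, p, 2 + v, p + 1]) 1 cs (y * F) msk p (length cs) @
      [p + length cs, 0, 2] = concat (map encode_trans (gadget_trans p (b y)))" for p y
    by (simp add: gadget_trans_def clauses_out_def assms)
  then show ?thesis
    by (induction N) (simp_all add: sweep_out_def Let_def)
qed

text \<open>Registers 3 and 2 contain 0 and 1 and double as the addresses of \<open>n\<close> and of
  the number of clauses. Shifting \<open>n + 1\<close> right rounds \<open>n / 2\<close> up. The
  words written are the length of the word and its opening delimiter.\<close>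

definition setup_code :: "instr list" where
  "setup_code = [Const 2 1, Op Add 1 0 3, Load 4 3, Load 6 2, Op Add 4 4 2, Op Shr 4 4 2,
     Op Shl 5 2 4, Op Add 7 6 2, Op Mul 7 7 5, Const 17 1, Op Sub 18 5 2,
     Const 13 2, Op Add 13 13 7] @ emit 13 @ emit_consts [3]"

definition emit_state_count :: "instr list" where
  "emit_state_count = [Const 13 4, Op Add 13 13 7] @ emit 13"

definition emit_trans_count :: "instr list" where
  "emit_trans_count = [Op Add 13 7 7, Const 14 8, Op Add 13 13 14] @ emit 13"

text \<open>The last instructions retarget the machine to the second half: the mask is multiplied by
  \<open>N\<close>, the factor becomes \<open>N\<close>, and gadget states start at 4 behind the
  shared ones.\<close>

definition middle_code :: "instr list" where
  "middle_code = emit_consts [3] @ emit_state_count @ emit_consts [4, 0, 3] @ emit_trans_count @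
     emit_consts (concat (map encode_trans loop_trans)) @ [Op Add 17 5 3, Op Mul 18 18 5, Const 16 4]"

text \<open>The last instruction puts the length of the instance, next free address minus base, into
  register 20, which is register 0 of the simulated program.\<close>

definition reduction_code :: code where
  "reduction_code = (\<lambda>_. setup_code) ;; sweep_code (emit_consts [2]) (emit 12) [] ;;
     (\<lambda>_. middle_code) ;; sweep_code gadget_head gadget_step gadget_tail ;;
     (\<lambda>_. [Op Sub 20 0 1])"

text \<open>The factor \<open>F\<close> is \<open>1\<close> for the first half of the variables and \<open>2\<^sup>h\<close> for the second one.\<close>

definition half_bits :: "nat list list \<Rightarrow> nat \<Rightarrow> nat \<Rightarrow> nat \<Rightarrow> nat list" where
  "half_bits cs h F x = map (clause_bit (x * F) ((2 ^ h - 1) * F)) cs"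

definition reduction_word :: "nat list list \<Rightarrow> nat \<Rightarrow> nat list" where
  "reduction_word cs h = blocks_word (half_bits cs h 1) (2 ^ h)"

definition reduction_trans :: "nat list list \<Rightarrow> nat \<Rightarrow> (nat \<times> nat option \<times> nat) list" where
  "reduction_trans cs h = gadgets_trans (length cs) (half_bits cs h (2 ^ h)) (2 ^ h)"

definition reduction_output :: "nat list list \<Rightarrow> nat \<Rightarrow> nat list" where
  "reduction_output cs h = (let k = 2 ^ h * (length cs + 1) in
     (2 + k) # reduction_word cs h @ [4 + k, 4, 0, 3, 8 + 2 * k] @
       concat (map encode_trans (reduction_trans cs h)))"

lemma length_emit: "length (emit r) = 2"
  by (simp add: emit_def)

lemma length_emit_consts: "length (emit_consts us) = 3 * length us"
  by (induction us) (simp_all add: emit_consts_def emit_def)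

section \<open>Correctness of the assembled reduction\<close>

lemma straight_setup_code:
  assumes "xs = n # k # us" and "R 0 = length xs" and "\<And>i. i \<noteq> 0 \<Longrightarrow> R i = 0"
  defines "N \<equiv> 2 ^ ((n + 1) div 2)"
  assumes B: "length xs + 3 \<le> B" "n + 1 \<le> B" "N \<le> B" "2 + N * (k + 1) \<le> B" "k + 1 \<le> B"
    and Q: "\<And>R'. R' 0 = length xs + 2 \<Longrightarrow> R' 1 = length xs \<Longrightarrow> R' 2 = 1 \<Longrightarrow> R' 5 = N \<Longrightarrow> R' 6 = k \<Longrightarrow>
      R' 7 = N * (k + 1) \<Longrightarrow> R' 17 = 1 \<Longrightarrow> R' 18 = N - 1 \<Longrightarrow>
      (\<And>i. i \<in> {3, 12, 16} \<or> 20 \<le> i \<Longrightarrow> R' i = 0) \<Longrightarrow> Q R' (memory (xs @ [2 + N * (k + 1), 3]))"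
  shows "straight B setup_code Q R (memory xs)"
proof -
  define K where "K = N * (k + 1)"
  have zero: "R i = 0" if "0 < i" for i
    using assms(3)[of i] that by simp
  have mem: "memory xs 0 = n" "memory xs (Suc 0) = k"
    using assms(1) by (simp_all add: memory_def)
  have halve: "drop_bit (Suc 0) m = m div 2" for m :: nat
    by (simp add: drop_bit_Suc)
  have N: "push_bit (Suc n div 2) (Suc 0) = N" "2 ^ (Suc n div 2) = N"
    by (simp_all add: N_def push_bit_eq_mult)
  have K: "N + k * N = K" by (simp add: K_def)
  have "straight B (emit_consts [3]) Q R1 (memory (xs @ [2 + K]))"
    if R1: "R1 0 = Suc (length xs)" "R1 1 = length xs" "R1 2 = 1" "R1 5 = N" "R1 6 = k" "R1 7 = K"
      "R1 17 = 1" "R1 18 = N - 1" "\<And>i. i \<in> {3, 12, 16} \<or> 20 \<le> i \<Longrightarrow> R1 i = 0" for R1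
  proof (rule straight_emit_consts)
    fix R'
    assume *: "\<forall>r. r \<notin> {0, 13} \<longrightarrow> R' r = R1 r" "R' 0 = length ((xs @ [2 + K]) @ [3])"
    have "R' i = 0" if "i \<in> {3, 12, 16} \<or> 20 \<le> i" for i
      using * R1(9)[OF that] that by auto
    then have "Q R' (memory (xs @ [2 + N * (k + 1), 3]))"
      using * R1 by (intro Q) (simp_all add: K_def)
    then show "Q R' (memory ((xs @ [2 + K]) @ [3]))"
      by (simp add: K_def)
  qed (use B R1 in \<open>simp_all add: K_def\<close>)
  note tail = this
  have KB: "K \<le> B" "N - Suc 0 \<le> B" "Suc (Suc K) \<le> B"
    using B by (simp_all add: K_def)
  have "Suc n div 2 \<le> B" using B(2) by simp
  then have "straight B [Const 2 1, Op Add 1 0 3, Load 4 3, Load 6 2, Op Add 4 4 2, Op Shr 4 4 2,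
     Op Shl 5 2 4, Op Add 7 6 2, Op Mul 7 7 5, Const 17 1, Op Sub 18 5 2, Const 13 2, Op Add 13 13 7]
     (\<lambda>R1 m. m = memory xs \<and> R1 0 = length xs \<and> R1 1 = length xs \<and> R1 2 = 1 \<and> R1 5 = N \<and>
       R1 6 = k \<and> R1 7 = K \<and> R1 13 = 2 + K \<and> R1 17 = 1 \<and> R1 18 = N - 1 \<and> (\<forall>i. i \<in> {3, 12, 16} \<or> 20 \<le> i \<longrightarrow> R1 i = 0))
     R (memory xs)"
    using B assms(2) mem by (simp add: zero halve N K) (intro conjI KB)
  then show ?thesis
    unfolding setup_code_def straight_append
  proof (rule straight_mono)
    fix R1 m :: "nat \<Rightarrow> nat"
    assume *: "m = memory xs \<and> R1 0 = length xs \<and> R1 1 = length xs \<and> R1 2 = 1 \<and> R1 5 = N \<and>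
       R1 6 = k \<and> R1 7 = K \<and> R1 13 = 2 + K \<and> R1 17 = 1 \<and> R1 18 = N - 1 \<and>
       (\<forall>i. i \<in> {3, 12, 16} \<or> 20 \<le> i \<longrightarrow> R1 i = 0)"
    have "straight B (emit_consts [3]) Q (R1(0 := Suc (length xs))) (memory (xs @ [2 + K]))"
    proof (rule tail)
      fix i :: nat
      assume i: "i \<in> {3, 12, 16} \<or> 20 \<le> i"
      from * have "\<forall>i. i \<in> {3, 12, 16} \<or> 20 \<le> i \<longrightarrow> R1 i = 0" by (elim conjE)
      from mp[OF spec[OF this] i] have "R1 i = 0" .
      moreover have "i \<noteq> 0" using i by auto
      ultimately show "(R1(0 := Suc (length xs))) i = 0" by simp
    qed (use * in simp_all)
    with * B show "straight B (emit 13) (straight B (emit_consts [3]) Q) R1 m"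
      by (simp add: emit_def memory_append)
  qed
qed

lemma straight_emit_state_count:
  assumes "R 0 = length ys" and "R 2 = 1" and "length ys + 1 \<le> B" and "4 + R 7 \<le> B"
    and Q: "\<And>R'. (\<forall>i. i \<notin> {0, 13} \<longrightarrow> R' i = R i) \<Longrightarrow> R' 0 = length ys + 1 \<Longrightarrow>
      Q R' (memory (ys @ [4 + R 7]))"
  shows "straight B emit_state_count Q R (memory ys)"
proof -
  have "Q (R(13 := 4 + R 7, 0 := length ys + 1)) (memory (ys @ [4 + R 7]))"
    by (rule Q) simp_all
  with assms(1-4) show ?thesis
    by (simp add: emit_state_count_def emit_def memory_append)
qed

lemma straight_emit_trans_count:
  assumes "R 0 = length ys" and "R 2 = 1" and "length ys + 1 \<le> B" and "8 + 2 * R 7 \<le> B"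
    and Q: "\<And>R'. (\<forall>i. i \<notin> {0, 13, 14} \<longrightarrow> R' i = R i) \<Longrightarrow> R' 0 = length ys + 1 \<Longrightarrow>
      Q R' (memory (ys @ [8 + 2 * R 7]))"
  shows "straight B emit_trans_count Q R (memory ys)"
proof -
  have "straight B emit_trans_count (\<lambda>R' m'. (\<forall>i. i \<notin> {0, 13, 14} \<longrightarrow> R' i = R i) \<and>
      R' 0 = length ys + 1 \<and> m' = memory (ys @ [8 + 2 * R 7])) R (memory ys)"
    using assms(1-4) by (simp add: emit_trans_count_def emit_def memory_append add.commute)
  then show ?thesis
    by (rule straight_mono) (elim conjE, hypsubst, rule Q)
qed

lemma straight_middle_code:
  assumes "R 0 = length ys" and "R 2 = 1" and "R 3 = 0" and "R 5 = N" and "R 7 = K" and "R 18 = msk"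
    and B: "length ys + 30 \<le> B" "2 * K + 8 \<le> B" "msk * N \<le> B" "N \<le> B"
    and Q: "\<And>R'. (\<forall>i. i \<notin> {0, 13, 14, 16, 17, 18} \<longrightarrow> R' i = R i) \<Longrightarrow> R' 0 = length ys + 30 \<Longrightarrow>
      R' 16 = 4 \<Longrightarrow> R' 17 = N \<Longrightarrow> R' 18 = msk * N \<Longrightarrow>
      Q R' (memory (ys @ [3, 4 + K, 4, 0, 3, 8 + 2 * K] @ concat (map encode_trans loop_trans)))"
  shows "straight B middle_code Q R (memory ys)"
proof -
  let ?l = "concat (map encode_trans loop_trans)"
  have l: "length ?l = 24" "\<forall>u\<in>set ?l. u \<le> B"
    using B(1) by (auto simp: loop_trans_def)
  show ?thesis
    unfolding middle_code_def straight_append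
  proof (rule straight_emit_consts, goal_cases)
    case (5 R1)
    then have R1: "R1 2 = 1" "R1 7 = K" "R1 0 = length ys + 1" using assms by simp_all
    show ?case
    proof (rule straight_emit_state_count, goal_cases)
      case (5 R2)
      then have R2: "R2 2 = 1" "R2 0 = length ys + 2" using R1 by simp_all
      show ?case
      proof (rule straight_emit_consts, goal_cases)
        case (5 R3)
        then have R3: "R3 2 = 1" "R3 7 = K" "R3 0 = length ys + 5"
          using R2 R1 \<open>\<forall>i. _ i \<longrightarrow> R2 i = R1 i\<close> by simp_all
        show ?case
        proof (rule straight_emit_trans_count, goal_cases)
          case (5 R4)
          then have R4: "R4 2 = 1" "R4 0 = length ys + 6" using R3 by simp_all
          show ?case
          proof (rule straight_emit_consts, goal_cases)
            case (5 R5)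
            have frame: "R5 i = R i" if "i \<notin> {0, 13, 14}" for i
            proof -
              have "R5 i = R4 i" "R4 i = R3 i" "R3 i = R2 i" "R2 i = R1 i" "R1 i = R i"
                using that 5(1) \<open>\<forall>i. _ i \<longrightarrow> R4 i = R3 i\<close> \<open>\<forall>i. _ i \<longrightarrow> R3 i = R2 i\<close>
                  \<open>\<forall>i. _ i \<longrightarrow> R2 i = R1 i\<close> \<open>\<forall>i. _ i \<longrightarrow> R1 i = R i\<close> by simp_all
              then show ?thesis by simp
            qed
            have "Q (R5(17 := N, 18 := msk * N, 16 := 4))
                (memory (ys @ [3, 4 + K, 4, 0, 3, 8 + 2 * K] @ ?l))"
              using 5(2) l(1) by (intro Q) (simp_all add: frame)
            then show ?case
              using B frame[of 5] frame[of 3] frame[of 18] assms(3-6) R1(2) R3(2) by simp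
          qed (use R4 R3 B l in simp_all)
        qed (use R3 B in auto)
      qed (use R2 B in auto)
    qed (use R1 B in auto)
  qed (use assms(1,2) B in auto)
qed

lemma reduction_output_eq:
  fixes h :: nat
  defines "N \<equiv> 2 ^ h"
  shows "reduction_output cs h = [2 + N * (length cs + 1), 3] @
     sweep_out (\<lambda>p. [2]) (\<lambda>p v. [v]) (\<lambda>p. []) 0 cs 1 (N - 1) 0 N @
     [3, 4 + N * (length cs + 1), 4, 0, 3, 8 + 2 * (N * (length cs + 1))] @
     concat (map encode_trans loop_trans) @
     sweep_out (\<lambda>p. [1, 3, p]) (\<lambda>p v. [p, 1, p + 1, p, 2 + v, p + 1]) (\<lambda>p. [p, 0, 2]) 1 cs N ((N - 1) * N) 4 N"
proof -
  have "half_bits cs h N y = map (clause_bit (y * N) ((N - 1) * N)) cs" for y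
    by (simp add: half_bits_def N_def)
  note gadgets = sweep_gadgets[of "half_bits cs h N", OF this]
  show ?thesis
    unfolding gadgets sweep_word
    by (simp add: reduction_output_def reduction_word_def reduction_trans_def blocks_word_def
        gadgets_trans_def half_bits_def Let_def flip: N_def)
qed

text \<open>The two sweeps together cost \<open>26 * L + 33\<close> per clause and 33 more per row.
  The 121 is 18 for the setup, 96 for the middle part, 3 for each sweep and 1 for the last
  subtraction. Values and mask of the second half are each at most \<open>N * N\<close>, hence
  \<open>2 * (N * N)\<close>.\<close>

lemma reaches_reduction_code:
  assumes xs: "xs = n # length cs # clause_words cs" and R: "R 0 = length xs" "\<And>i. i \<noteq> 0 \<Longrightarrow> R i = 0"
    and len: "\<And>c. c \<in> set cs \<Longrightarrow> length c \<le> L"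
  defines "h \<equiv> (n + 1) div 2"
  defines "N \<equiv> 2 ^ h"
  assumes B: "length xs + 2 * (N * (6 * length cs + 12)) + 50 \<le> B" "n + 1 \<le> B" "2 * (N * N) \<le> B"
      "\<And>c l. c \<in> set cs \<Longrightarrow> l \<in> set c \<Longrightarrow> 2 * (N * N) + l + 1 \<le> B"
    and Q: "\<And>R'. R' 1 = length xs \<Longrightarrow> R' 20 = length (reduction_output cs h) \<Longrightarrow>
      (\<And>i. 20 < i \<Longrightarrow> R' i = 0) \<Longrightarrow> Q R' (memory (xs @ reduction_output cs h))"
  shows "reaches B reduction_code (N * (length cs * (26 * L + 33) + 33) + 121) Q R (memory xs)"
proof -
  let ?M = "length cs" let ?K = "N * (length cs + 1)"
  let ?S1 = "sweep_out (\<lambda>p. [2]) (\<lambda>p v. [v]) (\<lambda>p. []) 0 cs 1 (N - 1) 0 N"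
  let ?S2 = "sweep_out (\<lambda>p. [1, 3, p]) (\<lambda>p v. [p, 1, p + 1, p, 2 + v, p + 1]) (\<lambda>p. [p, 0, 2]) 1 cs N
    ((N - 1) * N) 4 N"
  let ?ys1 = "xs @ [2 + ?K, 3]" let ?ys2 = "?ys1 @ ?S1"
  let ?ys3 = "?ys2 @ [3, 4 + ?K, 4, 0, 3, 8 + 2 * ?K] @ concat (map encode_trans loop_trans)"
  let ?ys4 = "?ys3 @ ?S2"
  have ys4: "?ys4 = xs @ reduction_output cs h"
    unfolding reduction_output_eq N_def by simp
  have N: "1 \<le> N" "N \<le> N * N" "(N - 1) * N \<le> N * N"
    by (simp_all add: N_def)
  define U where "U = N * (6 * ?M + 12)"
  have U: "N * (6 * ?M + 12) = U" by (simp add: U_def)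
  have K: "6 * ?K + 6 * N = U" by (simp add: U_def algebra_simps)
  have S: "length ?S1 \<le> U" "length ?S2 \<le> U"
    unfolding U_def by (rule order_trans[OF length_sweep_out_le]; simp)+
  have len3: "length ?ys3 = length xs + 32 + length ?S1"
    by (simp add: loop_trans_def)
  have MU: "?M \<le> U" "N \<le> U" "?K \<le> U" "2 * ?K \<le> U"
  proof -
    have "?M \<le> N * ?M"
      using N(1) by (cases N) simp_all
    with K show "?M \<le> U" "N \<le> U" "?K \<le> U" "2 * ?K \<le> U"
      unfolding distrib_left by linarith+
  qed
  have b: "3 \<le> B" "2 \<le> B" "?M \<le> B" "N \<le> B" "N * N \<le> B"
      "length ?ys1 + N * (6 * ?M + 12) + 6 \<le> B" "length ?ys3 + N * (6 * ?M + 12) + 6 \<le> B"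
      "4 + N * (1 * (?M + 1)) + 3 \<le> B"
    using B(1,3) MU S len3 unfolding U by simp_all
  have b_lit: "N * N + (N - 1) * N + l + 1 \<le> B" "N * 1 + (N - 1) + l + 1 \<le> B"
    if "c \<in> set cs" "l \<in> set c" for c l
    using B(4)[OF that] N by linarith+
  let ?sw1 = "sweep_code (emit_consts [2]) (emit 12) []"
  let ?sw2 = "sweep_code gadget_head gadget_step gadget_tail"
  let ?T1 = "N * (?M * (13 * L + length (emit 12) + 7) + length (emit_consts [2]) + length ([] :: instr list) + 7) + 3"
  let ?T2 = "N * (?M * (13 * L + length gadget_step + 7) + length gadget_head + length gadget_tail + 7) + 3"
  \<comment> \<open>Since \<open>reaches\<close> is a precondition for its continuation, the phases
    are verified from the last to the first.\<close>
  have final: "reaches B (?sw2 ;; (\<lambda>_. [Op Sub 20 0 1])) (?T2 + 1) Q R3 (memory ?ys3)"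
    if R3: "R3 0 = length ?ys3" "R3 1 = length xs" "R3 2 = 1" "R3 3 = 0" "R3 5 = N" "R3 6 = ?M" "R3 12 \<le> 1"
      "R3 16 = 4" "R3 17 = N" "R3 18 = (N - 1) * N" "\<And>i. 20 \<le> i \<Longrightarrow> R3 i = 0" for R3
  proof (rule reaches_seq, rule reaches_sweep_code[where hf = "\<lambda>p. [1, 3, p]"
        and f = "\<lambda>p v. [p, 1, p + 1, p, 2 + v, p + 1]" and tf = "\<lambda>p. [p, 0, 2]" and e = 1 and cs = cs
        and n = n and k = "length cs" and N = N and L = L], goal_cases)
    case (18 R4)
    have eq: "R4 0 = length ?ys4" "memory (?ys3 @ sweep_out (\<lambda>p. [1, 3, p])
        (\<lambda>p v. [p, 1, p + 1, p, 2 + v, p + 1]) (\<lambda>p. [p, 0, 2]) 1 cs (R3 17) (R3 18) (R3 16) N) = memory ?ys4"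
      using 18(3) R3 by simp_all
    have frame: "R4 i = R3 i" if "i = 1 \<or> 20 \<le> i" for i
      using 18(1) that by auto
    have "length ?ys4 \<le> B"
      using len3 S B(1) U by simp
    moreover have "Q (R4(20 := length (reduction_output cs h))) (memory ?ys4)"
      unfolding ys4 using frame R3 by (intro Q) auto
    moreover have "length ?ys4 - length xs = length (reduction_output cs h)"
      unfolding ys4 by simp
    ultimately have "straight B [Op Sub 20 0 1] Q R4 (memory ?ys4)"
      using eq(1) frame[of 1] R3(2) by simp
    then show ?case
      unfolding eq(2) by (intro reaches_straight_le) simp_all
  next
    case 1
    show ?case using b(1) by (rule emits_gadget_head)
  next
    case 2
    show ?case by (rule emits_gadget_step)
  next
    case 3
    show ?case by (rule emits_gadget_tail)
  qed (use R3 xs len b b_lit in simp_all)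
  have middle: "reaches B ((\<lambda>_. middle_code) ;; ?sw2 ;; (\<lambda>_. [Op Sub 20 0 1])) (96 + (?T2 + 1)) Q R2 (memory ?ys2)"
    if R2: "R2 0 = length ?ys2" "R2 1 = length xs" "R2 2 = 1" "R2 3 = 0" "R2 5 = N" "R2 6 = ?M" "R2 7 = ?K"
      "R2 12 \<le> 1" "R2 18 = N - 1" "\<And>i. 20 \<le> i \<Longrightarrow> R2 i = 0" for R2
  proof (intro reaches_seq[where c = "\<lambda>_. middle_code"] reaches_straight_le,
      rule straight_middle_code[where N = N and K = ?K and msk = "N - 1"], goal_cases)
    case (11 R3)
    have frame: "R3 i = R2 i" if "i \<in> {1, 2, 3, 5, 6, 12} \<or> 20 \<le> i" for i
      using 11(1) that by auto
    have "reaches B (?sw2 ;; (\<lambda>_. [Op Sub 20 0 1])) (?T2 + 1) Q R3 (memory ?ys3)"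
      using 11(2-5) R2 frame len3 by (intro final) simp_all
    then show ?case by simp
  next
    case 12
    show ?case
      by (simp add: middle_code_def emit_state_count_def emit_trans_count_def length_emit
          length_emit_consts loop_trans_def)
  next
    case 7
    show ?case using B(1) S U by simp
  next
    case 8
    show ?case using B(1) MU(4) U by simp
  next
    case 9
    show ?case using N(3) b(5) by (rule order_trans)
  qed (use R2 b in simp_all)
  have first: "reaches B (?sw1 ;; (\<lambda>_. middle_code) ;; ?sw2 ;; (\<lambda>_. [Op Sub 20 0 1]))
      (?T1 + (96 + (?T2 + 1))) Q R1 (memory ?ys1)"
    if R1: "R1 0 = length ?ys1" "R1 1 = length xs" "R1 2 = 1" "R1 5 = N" "R1 6 = ?M" "R1 7 = ?K" "R1 17 = 1"
      "R1 18 = N - 1" "\<And>i. i \<in> {3, 12, 16} \<or> 20 \<le> i \<Longrightarrow> R1 i = 0" for R1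
  proof (rule reaches_seq, rule reaches_sweep_code[where hf = "\<lambda>p. [2]" and f = "\<lambda>p v. [v]"
        and tf = "\<lambda>p. []" and e = 0 and cs = cs and n = n and k = "length cs" and N = N and L = L], goal_cases)
    case (18 R2)
    have frame: "R2 i = R1 i" if "i \<in> {1, 2, 3, 5, 6, 7, 18} \<or> 20 \<le> i" for i
      using 18(1) that by auto
    have "reaches B ((\<lambda>_. middle_code) ;; ?sw2 ;; (\<lambda>_. [Op Sub 20 0 1])) (96 + (?T2 + 1)) Q R2 (memory ?ys2)"
      using 18(2,3) R1 frame by (intro middle) simp_all
    then show ?case using R1 by simp
  next
    case 1
    show ?case using b(2) by (rule emits_word_head)
  next
    case 2
    show ?case by (rule emits_word_bit)
  next
    case 3
    show ?case by (rule emits_word_tail)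
  qed (use R1 xs len b b_lit in simp_all)
  have "reaches B ((\<lambda>_. setup_code) ;; ?sw1 ;; (\<lambda>_. middle_code) ;; ?sw2 ;; (\<lambda>_. [Op Sub 20 0 1]))
      (18 + (?T1 + (96 + (?T2 + 1)))) Q R (memory xs)"
  proof (intro reaches_seq[where c = "\<lambda>_. setup_code"] reaches_straight_le,
      rule straight_setup_code[where n = n and k = ?M and us = "clause_words cs"], goal_cases)
    case (9 R1)
    have "reaches B (?sw1 ;; (\<lambda>_. middle_code) ;; ?sw2 ;; (\<lambda>_. [Op Sub 20 0 1]))
      (?T1 + (96 + (?T2 + 1))) Q R1 (memory ?ys1)"
      using 9 by (intro first) (simp_all add: N_def h_def)
    then show ?case by (simp add: N_def h_def)
  next
    case 10
    show ?case by (simp add: setup_code_def length_emit length_emit_consts)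
  next
    case 4
    show ?case using B(1) by simp
  next
    case 5
    show ?case using B(2) by simp
  next
    case 6
    show ?case using b(4) by (simp add: N_def h_def)
  next
    case 7
    show ?case using B(1) MU(3) U by (simp add: N_def h_def)
  next
    case 8
    show ?case using B(1) MU(1) U by simp
  qed (use xs R in simp_all)
  then show ?thesis
    unfolding reduction_code_def
    by (rule reaches_mono) (simp_all add: gadget_step_def gadget_head_def gadget_tail_def length_emit
        length_emit_consts algebra_simps)
qed


section \<open>The program for k-SAT\<close>

definition answer_code :: "instr list" where
  "answer_code = [Load 19 1, Const 18 0, Store 18 19, Const 0 1]"

definition ksat_program :: "program \<Rightarrow> program" where
  "ksat_program P = (let l = length (reduction_code 0) in
     reduction_code 0 @ shift_program P l @ answer_code)"

lemma init_config_memory: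
  "init_config xs = \<lparr>pc = 0, regs = \<lambda>i. if i = 0 then length xs else 0, mem = memory xs\<rparr>"
  by (simp add: init_config_def memory_def fun_eq_iff)

section \<open>Size and entries of the instance\<close>

lemma length_reduction_word: "length (reduction_word cs h) = 2 + 2 ^ h * (length cs + 1)"
  unfolding reduction_word_def by (rule length_blocks_word) (simp add: half_bits_def)

lemma half_bits: "length (half_bits cs h F x) = length cs" "set (half_bits cs h F x) \<subseteq> {0, 1}"
  by (auto simp: half_bits_def clause_bit_def)

lemma length_reduction_trans: "length (reduction_trans cs h) = 8 + 2 * (2 ^ h * (length cs + 1))"
  unfolding reduction_trans_def by (rule length_gadgets_trans) (rule half_bits)

lemma length_concat_encode_trans: "length (concat (map encode_trans ts)) = 3 * length ts"
  by (induction ts) auto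

lemma length_reduction_output: "length (reduction_output cs h) = 32 + 7 * (2 ^ h * (length cs + 1))"
  by (simp add: reduction_output_def Let_def length_reduction_word length_reduction_trans
      length_concat_encode_trans)

text \<open>The word bound of the simulated program involves the sum of its input; bounding the
  entries keeps it polynomial in the size of the instance.\<close>

lemma reduction_output_le:
  assumes "u \<in> set (reduction_output cs h)"
  shows "u \<le> 8 + 2 * (2 ^ h * (length cs + 1))"
proof -
  let ?k = "2 ^ h * (length cs + 1)"
  let ?b = "half_bits cs h (2 ^ h)"
  have "enfa (gadgets_enfa (length cs) ?b (2 ^ h))"
    by (rule enfa_gadgets_enfa) (rule half_bits)+
  then have "set (reduction_trans cs h) \<subseteq> {..<4 + ?k} \<times> insert None (Some ` {..<4}) \<times> {..<4 + ?k}"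
    by (simp add: enfa_def gadgets_enfa_def reduction_trans_def)
  then have "u \<le> 8 + ?k" if "t \<in> set (reduction_trans cs h)" "u \<in> set (encode_trans t)" for t u
    using that by (cases t) fastforce
  moreover have "set (reduction_word cs h) \<subseteq> {..<4}"
    unfolding reduction_word_def by (rule blocks_word_delimited(2)) (rule half_bits)
  ultimately show ?thesis
    using assms by (fastforce simp: reduction_output_def Let_def)
qed

text \<open>Every block opens with the letter 2. Nonzero entries are the ones that differ from
  initially empty memory and so count as writes.\<close>

lemma nonzero_reduction_output: "2 ^ h \<le> card {i. i < length (reduction_output cs h) \<and> reduction_output cs h ! i \<noteq> 0}"
proof -
  have "n \<le> length (filter (\<lambda>u. u \<noteq> 0) (concat (map (\<lambda>x. 2 # f x) [0..<n])))" for n and f :: "nat \<Rightarrow> nat list"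
    by (induction n) (auto intro: le_SucI trans_le_add1)
  from this[of "2 ^ h" "half_bits cs h 1"] show ?thesis
    unfolding length_filter_conv_card[of "\<lambda>u. u \<noteq> 0", symmetric]
    by (simp add: reduction_output_def Let_def reduction_word_def blocks_word_def)
qed

text \<open>A step changes at most one memory cell. The lower bound on the time matters because it
  legitimates words with \<open>h\<close> bits.\<close>

lemma reduction_time_ge:
  assumes "runs P B (init_config xs) t c" and "mem c = memory (xs @ reduction_output cs h)"
  shows "2 ^ h \<le> t"
proof -
  let ?o = "reduction_output cs h"
  let ?D = "{a. mem c a \<noteq> mem (init_config xs) a}"
  have "(\<lambda>i. length xs + i) ` {i. i < length ?o \<and> ?o ! i \<noteq> 0} \<subseteq> ?D"
    by (auto simp: assms(2) init_config_memory memory_def nth_append)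
  then have "card ((\<lambda>i. length xs + i) ` {i. i < length ?o \<and> ?o ! i \<noteq> 0}) \<le> card ?D"
    using runs_changed_cells(1)[OF assms(1)] by (rule card_mono[rotated])
  also have "card ((\<lambda>i. length xs + i) ` {i. i < length ?o \<and> ?o ! i \<noteq> 0}) =
      card {i. i < length ?o \<and> ?o ! i \<noteq> 0}"
    by (intro card_image) (auto simp: inj_on_def)
  finally show ?thesis
    using nonzero_reduction_output[of h cs] runs_changed_cells(2)[OF assms(1)] by linarith
qed

text \<open>Chains the reduction, the simulation with two steps for each simulated one, and four
  final instructions. The lower bounds on \<open>t\<close> serve the word bound later.\<close>

lemma runs_ksat_program:
  assumes xs: "xs = n # length cs # clause_words cs" and len: "\<And>c. c \<in> set cs \<Longrightarrow> length c \<le> L"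
  defines "h \<equiv> (n + 1) div 2"
  assumes P: "runs P BP (init_config (reduction_output cs h)) tP cP" "halted P cP"
    and B: "length xs + 2 * (2 ^ h * (6 * length cs + 12)) + 50 + sum_list xs + (n + 1) + 2 * (2 ^ h * 2 ^ h) + BP
      + length xs \<le> B"
  shows "\<exists>t c. runs (ksat_program P) B (init_config xs) t c \<and> halted (ksat_program P) c \<and>
    regs c 0 = 1 \<and> mem c 0 = mem cP 0 \<and> 2 ^ h \<le> t \<and> tP \<le> t \<and>
    t \<le> 2 ^ h * (length cs * (26 * L + 33) + 33) + 125 + 2 * tP"
proof -
  let ?o = "reduction_output cs h" let ?l = "length (reduction_code 0)" let ?P = "ksat_program P"
  let ?R = "\<lambda>i. if i = 0 then length xs else 0"
  have P_eq: "?P = [] @ reduction_code (length ([] :: program)) @ (shift_program P ?l @ answer_code)"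
    by (simp add: ksat_program_def Let_def)
  have elem: "l \<le> sum_list xs" if "l \<in> set xs" for l
    using that by (rule member_le_sum_list) simp
  have "memory xs a \<le> sum_list xs" for a
    using elem by (simp add: memory_def)
  then have mem_le: "memory xs a \<le> B" for a
    using B order_trans[of "memory xs a" "sum_list xs" B] by simp
  then have w: "words_le B (init_config xs)"
    using B by (simp add: init_config_memory words_le_config)
  have "reaches B reduction_code (2 ^ h * (length cs * (26 * L + 33) + 33) + 121)
      (\<lambda>R m. R 1 = length xs \<and> R 20 = length ?o \<and> (\<forall>i>20. R i = 0) \<and> m = memory (xs @ ?o)) ?R (memory xs)"
    unfolding h_def
  proof (rule reaches_reduction_code[OF xs _ _ len])
    fix c l assume "c \<in> set cs" "l \<in> set c"
    then have "l \<in> set xs" using xs by (auto simp: clause_words_def)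
    from elem[OF this] show "2 * (2 ^ ((n + 1) div 2) * 2 ^ ((n + 1) div 2)) + l + 1 \<le> B"
      using B unfolding h_def by linarith
  qed (use B in \<open>simp_all add: h_def\<close>)
  from this[unfolded reaches_def, rule_format, of "[]" "shift_program P ?l @ answer_code", folded P_eq]
    w[unfolded init_config_memory]
  obtain t1 R1 where t1: "t1 \<le> 2 ^ h * (length cs * (26 * L + 33) + 33) + 121"
      "R1 1 = length xs" "R1 20 = length ?o" "\<And>i. i > 20 \<Longrightarrow> R1 i = 0"
    and r1: "runs ?P B (init_config xs) t1 \<lparr>pc = ?l, regs = R1, mem = memory (xs @ ?o)\<rparr>"
    by (auto simp: init_config_memory)
  let ?d = "\<lparr>pc = ?l, regs = R1, mem = memory (xs @ ?o)\<rparr>"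
  have "2 ^ h \<le> t1"
    using reduction_time_ge[OF r1] by simp
  have "R1 (i + 20) = (if i = 0 then length ?o else 0)" for i
    using t1(3,4) by simp
  then have sim: "simulates ?l (length P) (length xs) ?d (init_config ?o)"
    using t1(2) by (simp add: simulates_def init_config_memory memory_def nth_append)
  \<comment> \<open>The simulation adds its base \<open>length xs\<close> to the word bound, so the
    simulated program gets \<open>B\<close> reduced by it.\<close>
  have B_eq: "(B - length xs) + length xs = B"
    using B by simp
  have "runs P (B - length xs) (init_config ?o) tP cP"
    using P(1) by (rule runs_mono) (use B in simp)
  from simulates_runs[OF this sim, unfolded B_eq, of ?P "reduction_code 0" answer_code]
    runs_final_words_le[OF r1]
  obtain d where r2: "runs ?P B ?d (2 * tP) d" and d: "simulates ?l (length P) (length xs) d cP"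
    by (auto simp: ksat_program_def Let_def)
  let ?us = "reduction_code 0 @ shift_program P ?l"
  have d_eq: "d = \<lparr>pc = length ?us, regs = regs d, mem = mem d\<rparr>"
    using d P(2) by (simp add: simulates_def halted_def length_shift_program)
  have "reaches B (\<lambda>_. answer_code) (length answer_code)
      (\<lambda>R m. R 0 = 1 \<and> m 0 = mem cP 0) (regs d) (mem d)"
  proof (rule reaches_straight)
    have "mem d (length xs) = mem cP 0" "regs d 1 = length xs"
      using d by (auto simp: simulates_def dest: spec[of _ 0])
    then show "straight B answer_code (\<lambda>R m. R 0 = 1 \<and> m 0 = mem cP 0) (regs d) (mem d)"
      using B by (simp add: answer_code_def)
  qed
  from this[unfolded reaches_def, rule_format, of ?us "[]"] runs_final_words_le[OF r2] d_eq
  obtain t3 R3 m3 where t3: "t3 \<le> length answer_code" "R3 0 = 1" "m3 0 = mem cP 0"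
    and r3: "runs ?P B d t3 \<lparr>pc = length ?us + length answer_code, regs = R3, mem = m3\<rparr>"
    by (auto simp: ksat_program_def Let_def)
  define c where "c = \<lparr>pc = length ?us + length answer_code, regs = R3, mem = m3\<rparr>"
  note r3 = r3[folded c_def]
  have "runs ?P B (init_config xs) (t1 + (2 * tP + t3)) c"
    using r1 r2 r3 by (blast intro: runs_trans)
  moreover have "halted ?P c"
    by (simp add: c_def halted_def ksat_program_def Let_def)
  moreover have "length answer_code = 4"
    by (simp add: answer_code_def)
  ultimately show ?thesis
    using t1(1) t3 \<open>2 ^ h \<le> t1\<close>
    by (intro exI[of _ "t1 + (2 * tP + t3)"] exI[of _ c]) (auto simp: c_def)
qed

text \<open>Constants are absorbed by \<open>2 * G ^ i \<le> G ^ Suc i\<close>. The instance has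
  length at most \<open>G ^ 7\<close> and sum at most \<open>G ^ 12\<close>, so the base of the
  \<open>e\<close>-th power is at most \<open>G ^ 14\<close>; the other terms fit into
  \<open>G ^ 8\<close>, with room for the final addition.\<close>

lemma word_bound_poly:
  fixes G :: nat
  assumes "2 \<le> G" "N \<le> G" "M \<le> G" "n \<le> G" "lx \<le> G" "sx \<le> G" "tP \<le> G"
    and o: "lo = 32 + 7 * (N * (M + 1))" "so \<le> lo * (8 + 2 * (N * (M + 1)))"
  shows "lx + 2 * (N * (6 * M + 12)) + 50 + sx + (n + 1) + 2 * (N * N) + (2 + lo + so + tP) ^ e + lx
    \<le> G ^ (14 * e + 10)"
proof -
  have G: "2 * G ^ i \<le> G ^ Suc i" for i using assms(1) by simp
  have one: "1 \<le> G ^ i" for i using assms(1) by simp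
  have up: "G ^ i \<le> G ^ j" if "i \<le> j" for i j using that assms(1) by (intro power_increasing) auto
  have NM: "N * M \<le> G ^ 2" "N * N \<le> G ^ 2"
    using assms by (auto simp: power2_eq_square intro: mult_mono)
  have Gs: "2 * G \<le> G ^ 2" "4 \<le> G ^ 2" "2 * G ^ 2 \<le> G ^ 3" "8 \<le> G ^ 3"
  proof -
    show *: "2 * G \<le> G ^ 2" "2 * G ^ 2 \<le> G ^ 3"
      using G[of 1] G[of 2] by (simp_all add: numeral_2_eq_2 numeral_3_eq_3)
    show "4 \<le> G ^ 2" "8 \<le> G ^ 3" using * assms(1) by linarith+
  qed
  have K: "N * (M + 1) \<le> G ^ 3"
    using NM(1) assms(2) Gs by simp
  have "lo \<le> 11 * G ^ 3" using o(1) K Gs(4) by linarith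
  also have "\<dots> \<le> 2 * (2 * (2 * (2 * G ^ 3)))" by simp
  also have "\<dots> \<le> G ^ 7" using G[of 3] G[of 4] G[of 5] G[of 6] by simp
  finally have lo: "lo \<le> G ^ 7" .
  have "8 + 2 * (N * (M + 1)) \<le> 2 * (2 * G ^ 3)" using K Gs(4) by linarith
  also have "\<dots> \<le> G ^ 5" using G[of 3] G[of 4] by simp
  finally have "lo * (8 + 2 * (N * (M + 1))) \<le> G ^ 7 * G ^ 5" using lo by (intro mult_mono) auto
  then have so: "so \<le> G ^ 12" using o(2) by (simp add: power_add[symmetric])
  have "lo \<le> G ^ 12" by (rule order_trans[OF lo up]) simp
  moreover have "G \<le> G ^ 12" using up[of 1 12] by simp
  ultimately have "2 + lo + so + tP \<le> 2 * (2 * G ^ 12)"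
    using so assms(1,7) by linarith
  also have "\<dots> \<le> G ^ 14" using G[of 12] G[of 13] by simp
  finally have "(2 + lo + so + tP) ^ e \<le> (G ^ 14) ^ e" by (rule power_mono) simp
  then have BP: "(2 + lo + so + tP) ^ e \<le> G ^ (14 * e)" by (simp add: power_mult)
  have "lx + 2 * (N * (6 * M + 12)) + 50 + sx + (n + 1) + 2 * (N * N) + lx \<le> 4 * G + 12 * G ^ 2 + 24 * G + 51 + 2 * G ^ 2"
    using assms NM by (simp add: algebra_simps)
  also have "\<dots> \<le> 64 * G ^ 2" using Gs by linarith
  also have "\<dots> \<le> G ^ 8" using G[of 2] G[of 3] G[of 4] G[of 5] G[of 6] G[of 7] by simp
  finally have rest: "lx + 2 * (N * (6 * M + 12)) + 50 + sx + (n + 1) + 2 * (N * N) + lx \<le> G ^ 8" .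
  have "G ^ 8 + G ^ (14 * e) \<le> 2 * G ^ (14 * e + 8)"
    using up[of 8 "14 * e + 8"] up[of "14 * e" "14 * e + 8"] by simp
  also have "\<dots> \<le> G ^ (14 * e + 10)" by (rule order_trans[OF G up]) simp
  finally show ?thesis using rest BP by linarith
qed


section \<open>Running time\<close>

text \<open>\<open>x ^ n / fact n\<close> is one term of the exponential series, whose terms are all
  nonnegative.\<close>

lemma power_le_fact_exp:
  fixes x :: real
  assumes "0 \<le> x"
  shows "x ^ n \<le> fact n * exp x"
proof -
  have "(\<Sum>i\<in>{n}. x ^ i /\<^sub>R fact i) \<le> (\<Sum>i. x ^ i /\<^sub>R fact i)"
    using assms by (intro sum_le_suminf summable_exp_generic) auto
  then have "x ^ n / fact n \<le> exp x"
    by (simp add: exp_def divide_inverse mult.commute)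
  then show ?thesis
    by (simp add: divide_le_eq mult.commute)
qed

lemma poly_le_exp:
  fixes c :: real
  assumes "0 < c"
  obtains Cd where "0 < Cd" and "\<And>n. (real (2 * n + 2)) ^ k \<le> Cd * 2 powr (c * real n)"
proof
  \<comment> \<open>This makes \<open>exp (a * n)\<close> equal to \<open>2 powr (c * n)\<close>;
    the factor \<open>exp a\<close> in the constant pays for the shift from \<open>n\<close> to
    \<open>n + 1\<close>.\<close>
  define a where "a = c * ln 2"
  have a: "0 < a" using assms by (simp add: a_def)
  let ?Cd = "(2 / a) ^ k * fact k * exp a"
  show "0 < ?Cd" using a by simp
  fix n
  have "(real (2 * n + 2)) ^ k = (2 / a) ^ k * (a * (real n + 1)) ^ k"
    using a by (simp add: power_mult_distrib[symmetric] field_simps)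
  also have "\<dots> \<le> (2 / a) ^ k * (fact k * exp (a * (real n + 1)))"
    using a by (intro mult_left_mono power_le_fact_exp) auto
  also have "\<dots> = ?Cd * 2 powr (c * real n)"
    by (simp add: a_def powr_def exp_add[symmetric] algebra_simps)
  finally show "(real (2 * n + 2)) ^ k \<le> ?Cd * 2 powr (c * real n)" .
qed

text \<open>A finite set with at most \<open>k\<close> elements is the set of a list of length at
  most \<open>k\<close>, and such lists are easily counted. This makes the number of clauses
  polynomial in \<open>n\<close>.\<close>

lemma card_small_subsets_le:
  assumes "finite X" and "\<And>C. C \<in> F \<Longrightarrow> C \<subseteq> X \<and> card C \<le> k"
  shows "card F \<le> (k + 1) * (card X + 1) ^ k"
proof -
  let ?L = "{xs. set xs \<subseteq> X \<and> length xs \<le> k}"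
  have "F \<subseteq> set ` ?L"
  proof
    fix C assume "C \<in> F"
    with assms have "finite C" "C \<subseteq> X" "card C \<le> k"
      using finite_subset by blast+
    then obtain xs where "set xs = C" "distinct xs"
      using finite_distinct_list by blast
    with \<open>C \<subseteq> X\<close> \<open>card C \<le> k\<close> show "C \<in> set ` ?L"
      using distinct_card[of xs] by (intro image_eqI[of _ _ xs]) auto
  qed
  moreover have fin: "finite ?L"
    using assms(1) by (rule finite_lists_length_le)
  ultimately have "card F \<le> card ?L"
    by (meson card_image_le card_mono finite_imageI le_trans)
  also have "\<dots> = (\<Sum>i\<le>k. card X ^ i)"
    using assms(1) by (rule card_lists_length_le)
  also have "\<dots> \<le> (\<Sum>i\<le>k. (card X + 1) ^ k)"
  proof (rule sum_mono)
    fix i assume "i \<in> {..k}"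
    have "card X ^ i \<le> (card X + 1) ^ i" by (simp add: power_mono)
    also have "\<dots> \<le> (card X + 1) ^ k" using \<open>i \<in> {..k}\<close> by (intro power_increasing) auto
    finally show "card X ^ i \<le> (card X + 1) ^ k" .
  qed
  finally show ?thesis by simp
qed

text \<open>As \<open>W * m\<close> is at least 1, lowering \<open>\<epsilon>\<close> to
  \<open>\<epsilon>'\<close> only raises the power; the linear terms are covered because
  \<open>2 - 2 * \<epsilon>'\<close> is at least 1. The 44 is 30 for the product, 13 for the sum and
  1.\<close>

lemma matching_time_bound:
  fixes \<epsilon> :: real
  assumes "0 < \<epsilon>'" and "\<epsilon>' \<le> \<epsilon>" and "\<epsilon>' \<le> 1 / 2" and "1 \<le> K"
    and "1 \<le> W" "W \<le> 3 * K" and "1 \<le> m" "m \<le> 10 * K"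
  shows "1 + ((W * m) powr (1 - \<epsilon>) + (W + m)) \<le> 44 * K powr (2 - 2 * \<epsilon>')"
proof -
  have "1 \<le> W * m" using assms by (simp add: mult_ge1_I)
  then have "(W * m) powr (1 - \<epsilon>) \<le> (W * m) powr (1 - \<epsilon>')"
    using assms by (intro powr_mono) auto
  also have "\<dots> \<le> (30 * (K * K)) powr (1 - \<epsilon>')"
  proof (intro powr_mono2)
    have "W * m \<le> (3 * K) * (10 * K)" using assms by (intro mult_mono) auto
    then show "W * m \<le> 30 * (K * K)" by simp
  qed (use assms in auto)
  also have "\<dots> = 30 powr (1 - \<epsilon>') * K powr (2 - 2 * \<epsilon>')"
    using assms by (simp add: powr_mult powr_add[symmetric])
  also have "\<dots> \<le> 30 powr 1 * K powr (2 - 2 * \<epsilon>')"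
    using assms by (intro mult_right_mono powr_mono) auto
  finally have 1: "(W * m) powr (1 - \<epsilon>) \<le> 30 * K powr (2 - 2 * \<epsilon>')" by simp
  have "K powr 1 \<le> K powr (2 - 2 * \<epsilon>')"
    using assms by (intro powr_mono) auto
  with assms have "K \<le> K powr (2 - 2 * \<epsilon>')" "1 \<le> K powr (2 - 2 * \<epsilon>')" by auto
  with 1 assms show ?thesis by linarith
qed

section \<open>Correctness and cost for k-CNF formulas\<close>

lemma reduction_correct:
  fixes cs :: "literal list list"
  assumes R: "R \<in> {infix_rel, prefix_rel, extension_rel, left_extension_rel}"
    and answer: "answer \<in> {decision_answer,
                   min_answer whole_string, min_answer only_length,
                   max_answer whole_string, max_answer only_length}"
    and vars: "\<And>c. c \<in> set cs \<Longrightarrow> set c \<subseteq> {..<n} \<times> UNIV"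
  defines "h \<equiv> (n + 1) div 2"
  defines "ds \<equiv> map (map encode_literal) cs"
  defines "I \<equiv> (reduction_word ds h, gadgets_enfa (length ds) (half_bits ds h (2 ^ h)) (2 ^ h))"
  shows "matching_encoding I (reduction_output ds h)"
    and "answer R I ys \<Longrightarrow> ys \<noteq> [] \<and> hd ys = (if satisfiable (set (map set cs)) then 1 else 0)"
proof -
  let ?K = "2 ^ h * (length ds + 1)"
  let ?b = "half_bits ds h (2 ^ h)" and ?a = "half_bits ds h 1"
  let ?A = "gadgets_enfa (length ds) ?b (2 ^ h)"
  have b: "length (?b y) = length ds" "set (?b y) \<subseteq> {0, 1}"
    and a: "length (?a y) = length ds" "set (?a y) \<subseteq> {0, 1}" for y
    by (rule half_bits)+
  have w: "reduction_word ds h \<in> delimited" "set (reduction_word ds h) \<subseteq> {..<4}"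
    unfolding reduction_word_def using a(2) by (rule blocks_word_delimited)+
  have "distinct (reduction_trans ds h)"
    unfolding reduction_trans_def using b(1) by (rule distinct_gadgets_trans)
  moreover have "enfa ?A"
    by (rule enfa_gadgets_enfa) (rule b)+
  moreover have "states ?A = {..<4 + ?K}" "alphabet ?A = {..<4}" "start ?A = 0" "final ?A = 3"
      "trans ?A = set (reduction_trans ds h)"
    by (simp_all add: gadgets_enfa_def reduction_trans_def)
  moreover have "reduction_output ds h = length (reduction_word ds h) # reduction_word ds h @
      [4 + ?K, 4, 0, 3, length (reduction_trans ds h)] @ concat (map encode_trans (reduction_trans ds h))"
    by (simp add: reduction_output_def Let_def length_reduction_word length_reduction_trans)
  ultimately show "matching_encoding I (reduction_output ds h)"
    unfolding I_def matching_encoding.simps using w(2) by metis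
  have "reduction_word ds h \<in> language ?A \<longleftrightarrow>
      (\<exists>x<2 ^ h. \<exists>y<2 ^ h. \<forall>j<length ds. ?a x ! j = 0 \<or> ?b y ! j = 0)"
    unfolding reduction_word_def using b a by (rule blocks_word_in_language)
  also have "\<dots> \<longleftrightarrow> (\<exists>x<2 ^ h. \<exists>y<2 ^ h. \<forall>d\<in>set ds. clause_bit x (2 ^ h - 1) d = 0 \<or>
      clause_bit (y * 2 ^ h) ((2 ^ h - 1) * 2 ^ h) d = 0)"
    by (simp add: half_bits_def all_set_conv_all_nth)
  also have "\<dots> \<longleftrightarrow> satisfiable (set (map set cs))"
    using satisfiable_split[of cs n h, OF vars] by (simp add: ds_def h_def)
  finally have sat: "reduction_word ds h \<in> language ?A \<longleftrightarrow> satisfiable (set (map set cs))" .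
  have "language ?A \<subseteq> delimited"
    using b by (rule language_gadgets_enfa_delimited)
  from matches_delimited[OF R this w(1)] have "matches R (reduction_word ds h) ?A =
      (if satisfiable (set (map set cs)) then {reduction_word ds h} else {})"
    unfolding sat .
  from answer_singleton[OF answer this]
  show "answer R I ys \<Longrightarrow> ys \<noteq> [] \<and> hd ys = (if satisfiable (set (map set cs)) then 1 else 0)"
    unfolding I_def by auto
qed

text \<open>The bound in \<open>ram_run\<close> contains the running time, known only afterwards.
  The run is therefore built under the explicit bound \<open>?B\<close>, which is enlarged at the
  end.\<close>

lemma ram_run_ksat_program:
  fixes cs :: "literal list list"
  assumes xs: "xs = n # length cs # concat (map encode_clause cs)"
    and len: "\<And>c. c \<in> set cs \<Longrightarrow> length c \<le> L"
  defines "h \<equiv> (n + 1) div 2"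
  defines "ds \<equiv> map (map encode_literal) cs"
  assumes run: "ram_run P e (reduction_output ds h) tP ys" and "ys \<noteq> []"
  shows "\<exists>t. ram_run (ksat_program P) (14 * e + 10) xs t [hd ys] \<and>
    t \<le> 2 ^ h * (length cs * (26 * L + 33) + 33) + 125 + 2 * tP"
proof -
  have xs': "xs = n # length ds # clause_words ds"
    by (simp add: xs ds_def clause_words_def encode_clause_def[abs_def] comp_def)
  let ?o = "reduction_output ds h"
  let ?BP = "(2 + length ?o + sum_list ?o + tP) ^ e"
  let ?B = "length xs + 2 * (2 ^ h * (6 * length ds + 12)) + 50 + sum_list xs + (n + 1) +
    2 * (2 ^ h * 2 ^ h) + ?BP + length xs"
  obtain cP where cP: "runs P ?BP (init_config ?o) tP cP" "halted P cP" "ram_output cP = ys"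
    using run by (auto simp: ram_run_runs)
  have "length d \<le> L" if "d \<in> set ds" for d
    using that len by (auto simp: ds_def)
  from runs_ksat_program[OF xs' this cP(1,2)[unfolded h_def] order_refl]
  obtain t c where run': "runs (ksat_program P) ?B (init_config xs) t c"
      "halted (ksat_program P) c" "regs c 0 = 1" "mem c 0 = mem cP 0"
    and t: "2 ^ h \<le> t" "tP \<le> t" "t \<le> 2 ^ h * (length ds * (26 * L + 33) + 33) + 125 + 2 * tP"
    unfolding h_def by auto
  have "mem cP 0 = hd ys"
    using cP(3) \<open>ys \<noteq> []\<close>
    by (cases "regs cP 0") (auto simp: ram_output_def upt_conv_Cons simp del: upt_Suc)
  then have out: "ram_output c = [hd ys]"
    using run'(3,4) by (simp add: ram_output_def)
  let ?G = "2 + length xs + sum_list xs + t"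
  have "sum_list ?o \<le> length ?o * (8 + 2 * (2 ^ h * (length ds + 1)))"
    using sum_list_mono[of ?o "\<lambda>u. u" "\<lambda>u. 8 + 2 * (2 ^ h * (length ds + 1))"] reduction_output_le[of _ ds h]
    by (simp add: sum_list_triv)
  \<comment> \<open>Here \<open>2 ^ h \<le> t\<close> enters: it makes numbers near
    \<open>2 ^ n\<close> polynomial in the running time.\<close>
  then have "?B \<le> ?G ^ (14 * e + 10)"
    using t xs' by (intro word_bound_poly length_reduction_output) auto
  with run'(1) have "runs (ksat_program P) (?G ^ (14 * e + 10)) (init_config xs) t c"
    by (rule runs_mono)
  then show ?thesis
    using run'(2) out t(3) by (auto simp: ram_run_runs ds_def)
qed

text \<open>The listing has no repetitions, so it is as long as \<open>F\<close> has clauses, each a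
  set of at most \<open>k\<close> of \<open>2 * n\<close> literals. The extra 1 matches the factor
  \<open>length cs + 1\<close> of the instance size.\<close>

lemma ksat_instance_bounds:
  assumes "ksat_instance k (n, F)" and "\<forall>c\<in>set cs. distinct c" and "distinct (map set cs)"
    and "set (map set cs) = F"
  shows "c \<in> set cs \<Longrightarrow> set c \<subseteq> {..<n} \<times> UNIV" and "c \<in> set cs \<Longrightarrow> length c \<le> k"
    and "length cs + 1 \<le> (k + 2) * (2 * n + 2) ^ k"
proof -
  have C: "C \<subseteq> {..<n} \<times> UNIV \<and> card C \<le> k" if "C \<in> F" for C
    using assms(1) that by simp
  show "c \<in> set cs \<Longrightarrow> set c \<subseteq> {..<n} \<times> UNIV" "c \<in> set cs \<Longrightarrow> length c \<le> k"
    using C[of "set c"] assms(2,4) distinct_card[of c] by auto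
  have "length cs = card F"
    using distinct_card[OF assms(3)] assms(4) by simp
  also have "\<dots> \<le> (k + 1) * (card ({..<n} \<times> (UNIV :: bool set)) + 1) ^ k"
    by (rule card_small_subsets_le) (use C in auto)
  also have "\<dots> \<le> (k + 1) * (2 * n + 2) ^ k"
    by (intro mult_left_mono power_mono) auto
  finally have "length cs + 1 \<le> (k + 1) * (2 * n + 2) ^ k + (2 * n + 2) ^ k"
    by (rule add_mono) simp
  then show "length cs + 1 \<le> (k + 2) * (2 * n + 2) ^ k"
    by (simp add: algebra_simps)
qed

theorem theorem7p1:
  fixes R :: "nat list \<Rightarrow> nat list \<Rightarrow> bool"
    and answer :: "(nat list \<Rightarrow> nat list \<Rightarrow> bool) \<Rightarrow> matching_instance \<Rightarrow> nat list \<Rightarrow> bool"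
    and \<epsilon> :: real
  assumes "R \<in> {infix_rel, prefix_rel, extension_rel, left_extension_rel}"
    and "answer \<in> {decision_answer,
                   min_answer whole_string, min_answer only_length,
                   max_answer whole_string, max_answer only_length}"
    and "\<epsilon> > 0"
    and "solvable_in_time matching_encoding (answer R) (matching_time \<epsilon>)"
  shows "\<not> SETH"
proof -
  obtain P e C where P: "\<And>I xs. matching_encoding I xs \<Longrightarrow>
      \<exists>t ys. ram_run P e xs t ys \<and> answer R I ys \<and> real t \<le> C * (1 + matching_time \<epsilon> I)"
    using assms(4) unfolding solvable_in_time_def by blast
  define \<epsilon>' where "\<epsilon>' = min \<epsilon> (1 / 2)"
  have \<epsilon>': "0 < \<epsilon>'" "\<epsilon>' \<le> \<epsilon>" "\<epsilon>' \<le> 1 / 2"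
    using assms(3) by (auto simp: \<epsilon>'_def)
  have "solvable_in_time (ksat_encoding k) sat_answer (\<lambda>(n, F). 2 powr ((1 - \<epsilon>' / 2) * real n))" for k
  proof -
    \<comment> \<open>This polynomial is paid for by half of the saving. Its degree is
      \<open>2 * k\<close> because the number of clauses enters with a power below 2.\<close>
    obtain D where D: "0 < D" "\<And>n. real (2 * n + 2) ^ (2 * k) \<le> D * 2 powr (\<epsilon>' / 2 * real n)"
      using poly_le_exp[of "\<epsilon>' / 2" "2 * k"] \<epsilon>'(1) by auto
    \<comment> \<open>Reduction and simulation, the latter doubled, per unit of
      \<open>K powr (2 - 2 * \<epsilon>')\<close>. The 191 collects 33, 33 and 125; the absolute
      value is there because \<open>C\<close> may be negative.\<close>
    define c where "c = 26 * real k + 191 + 2 * (\<bar>C\<bar> * 44)"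
    have c: "0 \<le> c" by (simp add: c_def)
    have "\<exists>t ys. ram_run (ksat_program P) (14 * e + 10) xs t ys \<and> sat_answer (n, F) ys \<and>
        real t \<le> c * (4 * real (k + 2) ^ 2) * D * (1 + 2 powr ((1 - \<epsilon>' / 2) * real n))"
      if enc: "ksat_encoding k (n, F) xs" for n F xs
    proof -
      obtain cs where inst: "ksat_instance k (n, F)" "\<forall>c\<in>set cs. distinct c" "distinct (map set cs)"
          "set (map set cs) = F" and xs: "xs = n # length cs # concat (map encode_clause cs)"
        using enc by auto
      note cs = ksat_instance_bounds[OF inst]
      define h where "h = (n + 1) div 2"
      define ds where "ds = map (map encode_literal) cs"
      define A where "A = gadgets_enfa (length ds) (half_bits ds h (2 ^ h)) (2 ^ h)"
      define w where "w = reduction_word ds h"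
      note red = reduction_correct[of R answer cs n, OF assms(1,2) cs(1), folded h_def ds_def, folded A_def w_def]
      obtain tP ys where run: "ram_run P e (reduction_output ds h) tP ys" and ans: "answer R (w, A) ys"
          and tP: "real tP \<le> C * (1 + matching_time \<epsilon> (w, A))"
        using P[OF red(1)] by auto
      have ys: "ys \<noteq> []" "hd ys = (if satisfiable F then 1 else 0)"
        using red(2)[OF _ ans] inst(4) by auto
      obtain t where t: "ram_run (ksat_program P) (14 * e + 10) xs t [hd ys]"
          "t \<le> 2 ^ h * (length cs * (26 * k + 33) + 33) + 125 + 2 * tP"
        using ram_run_ksat_program[OF xs cs(2) run[unfolded ds_def h_def] ys(1)] unfolding h_def by auto
      define K where "K = 2 ^ h * (length cs + 1)"
      have "(1 :: nat) \<le> 2 ^ h" by simp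
      moreover have "2 ^ h \<le> K" "2 ^ h * length cs \<le> K"
        by (simp_all add: K_def)
      ultimately have K: "1 \<le> K" "2 ^ h \<le> K" "2 ^ h * length cs \<le> K"
        by linarith+
      have "2 ^ h * (length cs * (26 * k + 33) + 33) + 125 \<le> (26 * k + 191) * K"
      proof -
        have "2 ^ h * (length cs * (26 * k + 33) + 33) + 125 =
            (26 * k + 33) * (2 ^ h * length cs) + 33 * 2 ^ h + 125" by (simp add: algebra_simps)
        also have "\<dots> \<le> (26 * k + 33) * K + 33 * K + 125 * K"
          using K by (intro add_mono mult_left_mono) auto
        also have "\<dots> = (26 * k + 191) * K" by (simp add: algebra_simps)
        finally show ?thesis .
      qed
      with t(2) have "real t \<le> real ((26 * k + 191) * K + 2 * tP)"
        by (intro of_nat_mono) simp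
      then have t': "real t \<le> (26 * real k + 191) * K + 2 * real tP" by simp
      let ?p = "real K powr (2 - 2 * \<epsilon>')"
      have size: "length w = 2 + K" "size_enfa A = 8 + 2 * K"
        unfolding w_def A_def K_def
        by (simp_all add: length_reduction_word size_gadgets_enfa half_bits ds_def)
      have "1 + matching_time \<epsilon> (w, A) \<le> 44 * ?p"
        unfolding matching_time.simps using \<epsilon>' K(1) by (intro matching_time_bound) (simp_all add: size)
      moreover have "0 \<le> 1 + matching_time \<epsilon> (w, A)" by simp
      ultimately have "C * (1 + matching_time \<epsilon> (w, A)) \<le> \<bar>C\<bar> * (44 * ?p)"
        by (intro mult_mono) auto
      moreover have "real K \<le> ?p"
        using powr_mono[of 1 "2 - 2 * \<epsilon>'" "real K"] K(1) \<epsilon>'(3) by simp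
      then have "(26 * real k + 191) * K \<le> (26 * real k + 191) * ?p"
        by (intro mult_left_mono) auto
      ultimately have "real t \<le> c * ?p"
        using t' tP unfolding c_def by (simp add: algebra_simps)
      also have "\<dots> \<le> c * ((4 * real (k + 2) ^ 2) * D * 2 powr ((1 - \<epsilon>' / 2) * real n))"
      proof (rule mult_left_mono[OF _ c])
        \<comment> \<open>The exponential part of \<open>K\<close>; rounding \<open>h\<close> up
          costs a factor of at most 2. Its exponent \<open>2 - 2 * \<epsilon>'\<close> is kept
          exact, while the polynomial part may be raised to the full square.\<close>
        define y where "y = 2 powr (real n / 2)"
        define M where "M = real (k + 2) * real (2 * n + 2) ^ k"
        have M: "real (length cs + 1) \<le> M"
          using of_nat_mono[OF cs(3), where 'a = real] unfolding M_def of_nat_mult of_nat_power .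
        then have "1 \<le> M" by simp
        have "real h \<le> 1 / 2 + real n / 2" by (simp add: h_def)
        then have "2 powr real h \<le> 2 powr (1 / 2 + real n / 2)" by simp
        also have "\<dots> = 2 powr (1 / 2) * y" by (simp add: y_def powr_add)
        also have "\<dots> \<le> 2 * y"
          using powr_mono[of "1 / 2" 1 "2 :: real"] by (intro mult_right_mono) (simp_all add: y_def)
        finally have "2 ^ h \<le> 2 * y" by (simp add: powr_realpow)
        then have "real K \<le> 2 * y * M"
          unfolding K_def of_nat_mult using M by (intro mult_mono) (auto simp: y_def)
        then have "?p \<le> (y * (2 * M)) powr (2 - 2 * \<epsilon>')"
          using \<epsilon>' by (intro powr_mono2) (auto simp: mult_ac)
        also have "\<dots> = y powr (2 - 2 * \<epsilon>') * (2 * M) powr (2 - 2 * \<epsilon>')"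
          by (rule powr_mult)
        also have "\<dots> \<le> y powr (2 - 2 * \<epsilon>') * (2 * M) powr 2"
          using \<epsilon>' \<open>1 \<le> M\<close> by (intro mult_left_mono powr_mono) auto
        also have "y powr (2 - 2 * \<epsilon>') = 2 powr ((1 - \<epsilon>') * real n)"
          by (simp add: y_def powr_powr algebra_simps)
        also have "(2 * M) powr 2 = (4 * real (k + 2) ^ 2) * real (2 * n + 2) ^ (2 * k)"
          using \<open>1 \<le> M\<close> by (simp add: M_def power_mult_distrib power_mult[symmetric] mult.commute)
        also have "2 powr ((1 - \<epsilon>') * real n) * \<dots> \<le>
            2 powr ((1 - \<epsilon>') * real n) * ((4 * real (k + 2) ^ 2) * (D * 2 powr (\<epsilon>' / 2 * real n)))"
          by (intro mult_left_mono D(2)) auto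
        also have "\<dots> = (4 * real (k + 2) ^ 2) * D * (2 powr ((1 - \<epsilon>') * real n) * 2 powr (\<epsilon>' / 2 * real n))"
          by simp
        also have "2 powr ((1 - \<epsilon>') * real n) * 2 powr (\<epsilon>' / 2 * real n) = 2 powr ((1 - \<epsilon>' / 2) * real n)"
          by (simp add: powr_add[symmetric] algebra_simps)
        finally show "?p \<le> (4 * real (k + 2) ^ 2) * D * 2 powr ((1 - \<epsilon>' / 2) * real n)" .
      qed
      also have "\<dots> \<le> c * (4 * real (k + 2) ^ 2) * D * (1 + 2 powr ((1 - \<epsilon>' / 2) * real n))"
        using c D(1) by (simp add: distrib_left mult_ac)
      finally show ?thesis
        using t(1) ys(2) by (intro exI[of _ t] exI[of _ "[hd ys]"]) simp
    qed
    then show ?thesis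
      unfolding solvable_in_time_def
      by (intro exI[of _ "ksat_program P"] exI[of _ "14 * e + 10"]
          exI[of _ "c * (4 * real (k + 2) ^ 2) * D"]) auto
  qed
  \<comment> \<open>The same \<open>\<delta> = \<epsilon>' / 2\<close> serves every
    \<open>k\<close>, which is what refutes the hypothesis.\<close>
  then show ?thesis
    unfolding SETH_def using \<epsilon>'(1) by (auto intro!: exI[of _ "\<epsilon>' / 2"])
qed

end
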